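(* Let $\mathcal{F}$ be a class of graphs. The following statements are equivalent: (i) $\mathcal{F}$ has bounded star choice number; (ii) $\mathcal{F}$ has bounded arrangeability; (iii) there is a constant $C_\mathcal{F}$ such that every $G\in\mathcal{F}$ and every neighborhood system $\Sigma$ for $G$ satisfy $\mathit{ch}(\Sigma)\le C_\mathcal{F}\cdot\rho(\Sigma)$; (iv) there is a function $f_\mathcal{F}$ such that every $G\in\mathcal{F}$ and every neighborhood system $\Sigma$ for $G$ satisfy $\mathit{ch}(\Sigma)\le f_\mathcal{F}(\rho(\Sigma))$; (v) the supremum of $\mathit{ch}(\Sigma)$ over all $G\in\mathcal{F}$ and all neighborhood systems $\Sigma$ for $G$ with $\rho(\Sigma)=2$ is finite.
   Context: Graphs are finite and simple. For a graph $G=(V,E)$, a neighborhood system for $G$ is a collection $(\Sigma(v))_{v\in V}$ with $\Sigma(v)\subseteq N(v)$ (the set of neighbors of $v$), and $\rho(\Sigma)=\max_v|\Sigma(v)|$. Given lists $L(v)$ of colors, a $\Sigma$-$L$-coloring assigns each $v$ a color from $L(v)$ so that any two distinct vertices lying together in some $\Sigma(w)$ get different colors; $\mathit{ch}(\Sigma)$ is the minimum $k$ such that for every assignment of lists of size at least $k$ there is a $\Sigma$-$L$-coloring. A star coloring of $G$ is a proper coloring in which every two color classes induce a forest of stars; the star choice number $\mathit{ch}_s(G)$ is the minimum $k$ such that for every assignment of lists of size at least $k$ to the vertices, $G$ has a star coloring with each vertex colored from its list. The arrangeability of $G$ is the least $k$ such that there is a linear ordering $\prec$ of $V(G)$ such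 that for every vertex $v$, there are at most $k$ vertices $u\prec v$ having a common neighbor $w$ with $v$ such that $v\prec w$. A class has bounded star choice number (resp. bounded arrangeability) if this parameter is bounded by a constant over all graphs of the class.
   Formalization: In (iii) the inequality is required only for neighborhood systems with ρ(Σ) ≥ 1: if all Σ(v) are empty and G has a vertex, then ρ(Σ)=0 but ch(Σ)=1, so (iii) read literally fails for every class containing a nonempty graph, e.g. {K_1}. *)

theory Defs
  imports "Graph_Theory.Digraph_Component" "HOL-Library.Extended_Nat"
begin

text \<open>
  A finite simple graph is a \<^locale>\<open>pair_graph\<close>: a finite, symmetric, loop-free digraph
  without parallel arcs. An edge \<open>uv\<close> is the pair of arcs \<open>(u,v)\<close> and \<open>(v,u)\<close>.
  The parameters below are minima over sets of natural numbers that are nonempty for every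
  finite graph (the number of vertices is always large enough), so \<open>LEAST\<close> is meaningful.
\<close>

definition neighbors :: "'a pair_pre_digraph \<Rightarrow> 'a \<Rightarrow> 'a set" where
  "neighbors G v = {u. (v, u) \<in> parcs G}"

definition neighborhood_system :: "'a pair_pre_digraph \<Rightarrow> ('a \<Rightarrow> 'a set) \<Rightarrow> bool" where
  "neighborhood_system G \<Sigma> \<longleftrightarrow> (\<forall>v\<in>pverts G. \<Sigma> v \<subseteq> neighbors G v)"

text \<open>The inserted 0 only matters for the graph without vertices.\<close>

definition rho :: "'a pair_pre_digraph \<Rightarrow> ('a \<Rightarrow> 'a set) \<Rightarrow> nat" where
  "rho G \<Sigma> = Max (insert 0 ((\<lambda>v. card (\<Sigma> v)) ` pverts G))"

text \<open>
  Lists are finite sets of colors. Since the graphs and the lists are finite, taking the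
  natural numbers as colors is no restriction.
\<close>

definition lists_of_size_at_least :: "'a pair_pre_digraph \<Rightarrow> nat \<Rightarrow> ('a \<Rightarrow> nat set) \<Rightarrow> bool" where
  "lists_of_size_at_least G k L \<longleftrightarrow> (\<forall>v\<in>pverts G. finite (L v) \<and> k \<le> card (L v))"

definition system_list_coloring ::
    "'a pair_pre_digraph \<Rightarrow> ('a \<Rightarrow> 'a set) \<Rightarrow> ('a \<Rightarrow> nat set) \<Rightarrow> ('a \<Rightarrow> nat) \<Rightarrow> bool" where
  "system_list_coloring G \<Sigma> L c \<longleftrightarrow>
     (\<forall>v\<in>pverts G. c v \<in> L v) \<and>
     (\<forall>w\<in>pverts G. \<forall>u\<in>\<Sigma> w. \<forall>v\<in>\<Sigma> w. u \<noteq> v \<longrightarrow> c u \<noteq> c v)"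

definition system_choice_number :: "'a pair_pre_digraph \<Rightarrow> ('a \<Rightarrow> 'a set) \<Rightarrow> nat" where
  "system_choice_number G \<Sigma> =
     (LEAST k. \<forall>L. lists_of_size_at_least G k L \<longrightarrow> (\<exists>c. system_list_coloring G \<Sigma> L c))"

text \<open>Stars are the graphs \<open>K\<^bsub>1,m\<^esub>\<close> with \<open>m \<ge> 0\<close>; a single vertex is a star.\<close>

definition is_star :: "('a, 'b) pre_digraph \<Rightarrow> bool" where
  "is_star H \<longleftrightarrow>
     (\<exists>c\<in>verts H. arcs_ends H = {c} \<times> (verts H - {c}) \<union> (verts H - {c}) \<times> {c})"

text \<open>For a symmetric digraph, the strongly connected components are the connected components.\<close>

definition star_forest :: "('a, 'b) pre_digraph \<Rightarrow> bool" where
  "star_forest H \<longleftrightarrow> (\<forall>C\<in>pre_digraph.sccs H. is_star C)"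

definition proper_coloring :: "'a pair_pre_digraph \<Rightarrow> ('a \<Rightarrow> nat) \<Rightarrow> bool" where
  "proper_coloring G c \<longleftrightarrow> (\<forall>(u, v)\<in>parcs G. c u \<noteq> c v)"

definition star_coloring :: "'a pair_pre_digraph \<Rightarrow> ('a \<Rightarrow> nat) \<Rightarrow> bool" where
  "star_coloring G c \<longleftrightarrow> proper_coloring G c \<and>
     (\<forall>i j. i \<noteq> j \<longrightarrow> star_forest (with_proj G \<restriction> {v \<in> pverts G. c v = i \<or> c v = j}))"

definition star_choice_number :: "'a pair_pre_digraph \<Rightarrow> nat" where
  "star_choice_number G =
     (LEAST k. \<forall>L. lists_of_size_at_least G k L \<longrightarrow>
        (\<exists>c. star_coloring G c \<and> (\<forall>v\<in>pverts G. c v \<in> L v)))"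

text \<open>\<open>r\<close> is a reflexive linear order, so \<open>u \<prec> v\<close> is \<open>(u, v) \<in> r \<and> u \<noteq> v\<close>.\<close>

definition arrangeability :: "'a pair_pre_digraph \<Rightarrow> nat" where
  "arrangeability G =
     (LEAST k. \<exists>r. linear_order_on (pverts G) r \<and>
        (\<forall>v\<in>pverts G.
           card {u \<in> pverts G. (u, v) \<in> r \<and> u \<noteq> v \<and>
                   (\<exists>w \<in> neighbors G u \<inter> neighbors G v. (v, w) \<in> r \<and> v \<noteq> w)} \<le> k))"

end

theory Submission
  imports Defs "HOL-Library.FuncSet"
begin

text \<open>
  Everything passes through one property of \<open>G\<close>: the graphs \<open>H\<close> whose 1-subdivision is a subgraph
  of \<open>G\<close> have bounded degeneracy. If star or system choice numbers are bounded, this holds by a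
  defective version of Alon's theorem: if all degrees of \<open>H\<close> are large, some lists of size \<open>s\<close> force
  a vertex \<open>v\<close> with more than \<open>t\<close> neighbours of its own colour. With \<open>t = 0\<close> this contradicts a
  colouring of the system \<open>\<Sigma>\<close> that maps a subdivision vertex to its two neighbours; with \<open>t = s\<close> and
  the list \<open>{..<s}\<close> on all subdivision vertices, two of the subdivision vertices between \<open>v\<close> and
  its like-coloured neighbours share a colour and yield a bicoloured path on four vertices.

  Conversely the property bounds the degeneracy of \<open>G\<close> itself: for a suitable sparse set \<open>A\<close> most
  vertices have many neighbours in \<open>A\<close> and can be given pairwise distinct pairs of them.
  An arrangement is then built from its last vertex: among the vertices of low degree in the
  remaining set \<open>U\<close>, one has few partners with a common neighbour outside \<open>U\<close>, because each
  vertex outside accounts for a bounded number of pairs. Finally, a good arrangement yields all the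
  colourings greedily.
\<close>

section \<open>Lists that force monochromatic neighbours\<close>

lemma card_filter_add:
  "finite A \<Longrightarrow> card {x \<in> A. P x} + card {x \<in> A. \<not> P x} = card A"
  using card_Int_Diff[of A "Collect P"] by (simp add: Int_def set_diff_eq)

text \<open>\<open>D\<close> makes the union bound \<open>N * ((N - 1) / N) ^ D\<close> at most a
  quarter; it exists because powers of a number below 1 tend to 0.\<close>

lemma labelling_threshold:
  assumes "N \<ge> 1"
  shows "\<exists>D. 4 * N * (N - 1) ^ D \<le> (N::nat) ^ D"
proof -
  have "\<exists>D. (real (N - 1) / real N) ^ D < 1 / (4 * real N)"
    using assms by (intro real_arch_pow_inv) auto
  then obtain D where "(real (N - 1) / real N) ^ D < 1 / (4 * real N)" ..
  then have "4 * real N * real (N - 1) ^ D \<le> real N ^ D"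
    using assms by (simp add: power_divide divide_simps mult.commute split: if_splits)
  then have "real (4 * N * (N - 1) ^ D) \<le> real (N ^ D)" by simp
  then show ?thesis using of_nat_le_iff by blast
qed

text \<open>First-moment method by counting functions: a random labelling misses a fixed label on
  \<open>S v\<close> with probability at most \<open>((N - 1) / N) ^ D\<close>, so each vertex
  misses some label with probability at most 1/4, and some labelling is no worse than the
  average.\<close>

lemma ex_labelling:
  fixes U :: "'a set" and S :: "'a \<Rightarrow> 'a set" and N D :: nat
  assumes fin: "finite U" and S: "\<And>v. v \<in> U \<Longrightarrow> S v \<subseteq> U \<and> D \<le> card (S v)"
    and N: "N \<ge> 1" and D: "4 * N * (N - 1) ^ D \<le> N ^ D"
  shows "\<exists>f\<in>U \<rightarrow>\<^sub>E {..<N}. 4 * card {v \<in> U. \<not> {..<N} \<subseteq> f ` S v} \<le> card U"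
proof (rule ccontr)
  assume contra: "\<not> ?thesis"
  let ?n = "card U" and ?F = "U \<rightarrow>\<^sub>E {..<N}"
  let ?avoid = "\<lambda>v i. {f \<in> ?F. i \<notin> f ` S v}"
  have finF: "finite ?F" and cardF: "card ?F = N ^ ?n"
    using fin by (auto simp: finite_PiE card_PiE)
  have avoid: "card (?avoid v i) * N ^ D \<le> (N - 1) ^ D * N ^ ?n" if v: "v \<in> U" and i: "i < N" for v i
  proof -
    \<comment> \<open>Keeping only \<open>D\<close> elements of \<open>S v\<close> puts the avoiding
      labellings into a product of explicit size: \<open>N - 1\<close> labels on \<open>T\<close>,
      \<open>N\<close> elsewhere.\<close>
    obtain T where T: "T \<subseteq> S v" "card T = D"
      using S[OF v] obtain_subset_with_card_n by metis
    have TU: "T \<subseteq> U" using T S v by blast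
    have Dn: "D \<le> ?n" using T TU fin card_mono by metis
    let ?P = "\<Pi>\<^sub>E x\<in>U. if x \<in> T then {..<N} - {i} else {..<N}"
    have "?avoid v i \<subseteq> ?P"
    proof
      fix f assume f: "f \<in> ?avoid v i"
      then have "f x \<noteq> i" if "x \<in> T" for x using T that by auto
      then show "f \<in> ?P" using f by (auto simp: PiE_iff)
    qed
    moreover have "finite ?P" using fin by (intro finite_PiE) auto
    ultimately have "card (?avoid v i) \<le> card ?P" by (intro card_mono)
    also have "card ?P = (\<Prod>x\<in>U. if x \<in> T then N - 1 else N)"
      using fin i by (subst card_PiE) (auto intro!: prod.cong)
    also have "\<dots> = (N - 1) ^ D * N ^ (?n - D)"
    proof -
      have "(\<Prod>x\<in>U. if x \<in> T then N - 1 else N)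
          = (\<Prod>x\<in>T. if x \<in> T then N - 1 else N) * (\<Prod>x\<in>U - T. if x \<in> T then N - 1 else N)"
        unfolding prod.subset_diff[OF TU fin] by (rule mult.commute)
      also have "\<dots> = (N - 1) ^ D * N ^ (?n - D)"
        using T TU fin by (simp add: card_Diff_subset finite_subset)
      finally show ?thesis .
    qed
    finally have "card (?avoid v i) * N ^ D \<le> (N - 1) ^ D * N ^ (?n - D) * N ^ D" by simp
    also have "\<dots> = (N - 1) ^ D * N ^ ?n"
      using Dn by (simp add: mult.assoc flip: power_add)
    finally show ?thesis .
  qed
  have bad: "card {v \<in> U. \<not> {..<N} \<subseteq> f ` S v} \<le> (\<Sum>v\<in>U. \<Sum>i<N. of_bool (i \<notin> f ` S v))" for f
  proof -
    have "card {v \<in> U. \<not> {..<N} \<subseteq> f ` S v} = (\<Sum>v\<in>U. of_bool (\<not> {..<N} \<subseteq> f ` S v))"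
      using fin by (simp add: Int_def)
    also have "\<dots> \<le> (\<Sum>v\<in>U. \<Sum>i<N. of_bool (i \<notin> f ` S v))"
    proof (rule sum_mono)
      fix v show "of_bool (\<not> {..<N} \<subseteq> f ` S v) \<le> (\<Sum>i<N. of_bool (i \<notin> f ` S v) :: nat)"
      proof (cases "{..<N} \<subseteq> f ` S v")
        case False
        then obtain i where i: "i < N" "i \<notin> f ` S v" by auto
        have "(of_bool (i \<notin> f ` S v) :: nat) \<le> (\<Sum>i<N. of_bool (i \<notin> f ` S v))"
          using i by (intro member_le_sum) auto
        then show ?thesis using i False by simp
      qed simp
    qed
    finally show ?thesis .
  qed
  \<comment> \<open>Double counting: the strict failure contributes at least \<open>Suc ?n\<close>
    per labelling, while the averaged bound allows only \<open>?n\<close>.\<close>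
  have "N ^ ?n * Suc ?n = (\<Sum>f\<in>?F. Suc ?n)" using cardF by simp
  also have "\<dots> \<le> (\<Sum>f\<in>?F. 4 * (\<Sum>v\<in>U. \<Sum>i<N. of_bool (i \<notin> f ` S v)))"
  proof (rule sum_mono)
    fix f assume "f \<in> ?F"
    then have "?n < 4 * card {v \<in> U. \<not> {..<N} \<subseteq> f ` S v}" using contra by (auto simp: not_le)
    then show "Suc ?n \<le> 4 * (\<Sum>v\<in>U. \<Sum>i<N. of_bool (i \<notin> f ` S v))" using bad[of f] by linarith
  qed
  also have "\<dots> = 4 * (\<Sum>v\<in>U. \<Sum>i<N. card (?avoid v i))"
  proof -
    have "(\<Sum>f\<in>?F. \<Sum>v\<in>U. \<Sum>i<N. of_bool (i \<notin> f ` S v))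
        = (\<Sum>v\<in>U. \<Sum>f\<in>?F. \<Sum>i<N. of_bool (i \<notin> f ` S v) :: nat)" by (rule sum.swap)
    also have "\<dots> = (\<Sum>v\<in>U. \<Sum>i<N. \<Sum>f\<in>?F. of_bool (i \<notin> f ` S v))"
      by (intro sum.cong refl sum.swap)
    also have "\<dots> = (\<Sum>v\<in>U. \<Sum>i<N. card (?avoid v i))" using finF by (simp add: Int_def)
    finally show ?thesis by (simp flip: sum_distrib_left)
  qed
  finally have "N ^ ?n * Suc ?n * N ^ D \<le> 4 * (\<Sum>v\<in>U. \<Sum>i<N. card (?avoid v i)) * N ^ D"
    by (rule mult_right_mono) simp
  also have "\<dots> = 4 * (\<Sum>v\<in>U. \<Sum>i<N. card (?avoid v i) * N ^ D)"
    by (simp add: sum_distrib_right)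
  also have "\<dots> \<le> 4 * (\<Sum>v\<in>U. \<Sum>i<N. (N - 1) ^ D * N ^ ?n)"
    using avoid by (intro mult_left_mono sum_mono) auto
  also have "\<dots> = ?n * N ^ ?n * (4 * N * (N - 1) ^ D)" by simp
  also have "\<dots> \<le> ?n * N ^ ?n * N ^ D" using D by (rule mult_left_mono) simp
  finally show False using N by simp
qed

text \<open>Use \<open>q * M\<close> labels, cut into \<open>q\<close> groups of \<open>M\<close>.
  Some group is used on at most a \<open>1 / q\<close> fraction of \<open>U\<close>; a vertex that
  sees all labels sees this group completely, and residues mod \<open>M\<close> rename it to
  \<open>{..<M}\<close>.\<close>

lemma ex_sparse_labelled_set:
  fixes q M :: nat
  assumes q: "q \<ge> 1" and M: "M \<ge> 1"
  shows "\<exists>D. \<forall>(U :: 'a set) S. finite U \<and> (\<forall>v\<in>U. S v \<subseteq> U \<and> D \<le> card (S v)) \<longrightarrow>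
    (\<exists>B f. B \<subseteq> U \<and> q * card B \<le> card U \<and> f ` B \<subseteq> {..<M} \<and>
       4 * card {v \<in> U. \<not> {..<M} \<subseteq> f ` (S v \<inter> B)} \<le> card U)"
proof -
  let ?N = "q * M"
  have N: "?N \<ge> 1" using q M by simp
  obtain D where D: "4 * ?N * (?N - 1) ^ D \<le> ?N ^ D" using labelling_threshold[OF N] by blast
  show ?thesis
  proof (intro exI[of _ D] allI impI, elim conjE)
    fix U :: "'a set" and S
    assume fin: "finite U" and S: "\<forall>v\<in>U. S v \<subseteq> U \<and> D \<le> card (S v)"
    obtain f where f: "f \<in> U \<rightarrow>\<^sub>E {..<?N}"
      and bad: "4 * card {v \<in> U. \<not> {..<?N} \<subseteq> f ` S v} \<le> card U"
      using ex_labelling[OF fin _ N D] S by blast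
    let ?B = "\<lambda>j. {v \<in> U. f v div M = j}"
    have "\<exists>j<q. q * card (?B j) \<le> card U"
    proof (rule ccontr)
      assume "\<not> ?thesis"
      then have "(\<Sum>j<q. card U) < (\<Sum>j<q. q * card (?B j))"
        using q by (intro sum_strict_mono) (auto simp: lessThan_empty_iff)
      also have "\<dots> = q * card (\<Union>j<q. ?B j)"
        using fin by (subst card_UN_disjoint) (auto simp: sum_distrib_left)
      also have "\<dots> \<le> q * card U" using fin by (intro mult_left_mono card_mono) auto
      finally show False by simp
    qed
    then obtain j where j: "j < q" "q * card (?B j) \<le> card U" by blast
    let ?f = "\<lambda>v. f v mod M"
    have "{..<M} \<subseteq> ?f ` (S v \<inter> ?B j)" if "v \<in> U" "{..<?N} \<subseteq> f ` S v" for v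
    proof
      fix i assume "i \<in> {..<M}"
      then have i: "i < M" by simp
      have "j * M + i < (j + 1) * M" using i by simp
      also have "\<dots> \<le> ?N" using j by (intro mult_right_mono) auto
      finally have "j * M + i \<in> f ` S v" using that(2) by blast
      then obtain b where "b \<in> S v" "f b = j * M + i" by (metis imageE)
      then show "i \<in> ?f ` (S v \<inter> ?B j)" using S that i by (auto intro!: image_eqI[of _ _ b])
    qed
    then have "card {v \<in> U. \<not> {..<M} \<subseteq> ?f ` (S v \<inter> ?B j)} \<le> card {v \<in> U. \<not> {..<?N} \<subseteq> f ` S v}"
      using fin by (intro card_mono) auto
    then show "\<exists>B f. B \<subseteq> U \<and> q * card B \<le> card U \<and> f ` B \<subseteq> {..<M} \<and>
       4 * card {v \<in> U. \<not> {..<M} \<subseteq> f ` (S v \<inter> B)} \<le> card U"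
      using bad j M by (intro exI[of _ "?B j"] exI[of _ ?f]) auto
  qed
qed

text \<open>
  A derandomised union bound: at each \<open>v\<close> some index lies in \<open>X c v\<close> for at most a \<open>1 / s\<close>
  fraction of the remaining \<open>c\<close>.
\<close>

lemma ex_choice_defeating_all:
  fixes X :: "'c \<Rightarrow> 'v \<Rightarrow> nat set"
  assumes "finite W" "finite Y" "s \<ge> 1"
    and "\<And>c v. c \<in> Y \<Longrightarrow> v \<in> W \<Longrightarrow> card (X c v \<inter> {..<s * s}) \<le> s"
  shows "\<exists>F. s ^ card W * card {c \<in> Y. \<forall>v\<in>W. F v \<in> X c v} \<le> card Y \<and> (\<forall>v. F v < s * s)"
  using assms(1,4)
proof (induction W rule: finite_induct)
  case empty
  then show ?case using assms(3) by (auto intro!: exI[of _ "\<lambda>_. 0"])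
next
  case (insert v W)
  then obtain F where F: "s ^ card W * card {c \<in> Y. \<forall>v\<in>W. F v \<in> X c v} \<le> card Y" "\<forall>v. F v < s * s"
    by auto
  let ?Y = "{c \<in> Y. \<forall>v\<in>W. F v \<in> X c v}"
  \<comment> \<open>Averaging over \<open>j\<close>: each \<open>X c v\<close> contains at most
    \<open>s\<close> of the \<open>s * s\<close> indices.\<close>
  have "\<exists>j<s * s. s * card {c \<in> ?Y. j \<in> X c v} \<le> card ?Y"
  proof (rule ccontr)
    assume "\<not> ?thesis"
    then have "(\<Sum>j<s * s. card ?Y) < (\<Sum>j<s * s. s * card {c \<in> ?Y. j \<in> X c v})"
      using assms(3) by (intro sum_strict_mono) (auto simp: lessThan_empty_iff)
    also have "\<dots> = s * (\<Sum>j<s * s. \<Sum>c\<in>?Y. of_bool (j \<in> X c v))"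
      using assms(2) by (auto simp: sum_distrib_left intro!: sum.cong arg_cong[of _ _ card])
    also have "\<dots> = s * (\<Sum>c\<in>?Y. \<Sum>j<s * s. of_bool (j \<in> X c v))"
      by (subst sum.swap) simp
    also have "\<dots> = s * (\<Sum>c\<in>?Y. card (X c v \<inter> {..<s * s}))"
      by (intro arg_cong[of _ _ "times s"] sum.cong) (auto simp: Int_commute)
    also have "\<dots> \<le> s * (\<Sum>c\<in>?Y. s)"
      using insert.prems by (intro mult_left_mono sum_mono) auto
    finally show False by simp
  qed
  then obtain j where j: "j < s * s" "s * card {c \<in> ?Y. j \<in> X c v} \<le> card ?Y" by blast
  have eq: "{c \<in> Y. \<forall>u\<in>insert v W. (F(v := j)) u \<in> X c u} = {c \<in> ?Y. j \<in> X c v}"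
    using insert.hyps by auto
  have "s ^ card (insert v W) * card {c \<in> Y. \<forall>u\<in>insert v W. (F(v := j)) u \<in> X c u}
      = s ^ card W * (s * card {c \<in> ?Y. j \<in> X c v})"
    unfolding eq using insert.hyps by simp
  also have "\<dots> \<le> s ^ card W * card ?Y" using j by (intro mult_left_mono) auto
  also have "\<dots> \<le> card Y" by (rule F)
  finally show ?case using F j by (intro exI[of _ "F(v := j)"]) auto
qed

text \<open>
  The palette \<open>{..<s\<^sup>3}\<close> consists of \<open>s\<^sup>2\<close> blocks of size \<open>s\<close>. Lists on a sparse set \<open>B\<close> are such that
  most vertices \<open>v\<close> see every \<open>s\<close>-subset of the palette often in \<open>B\<close>; then, whatever the colouring of \<open>B\<close>,
  fewer than \<open>s\<close> blocks contain a colour that is still harmless at \<open>v\<close>.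
\<close>

lemma ex_lists_forcing_defect:
  fixes s t :: nat
  assumes s: "s \<ge> 2"
  shows "\<exists>D. \<forall>(U :: 'a set) S. finite U \<and> U \<noteq> {} \<and> (\<forall>v\<in>U. S v \<subseteq> U \<and> D \<le> card (S v)) \<longrightarrow>
    (\<exists>L :: 'a \<Rightarrow> nat set. (\<forall>v. finite (L v) \<and> card (L v) = s) \<and>
       (\<forall>c. (\<forall>v\<in>U. c v \<in> L v) \<longrightarrow> (\<exists>v\<in>U. t < card {u \<in> S v. c u = c v})))"
proof -
  let ?P = "{..<s * s * s}"
  define \<T> where "\<T> = {T. T \<subseteq> ?P \<and> card T = s}"
  have fin\<T>: "finite \<T>" unfolding \<T>_def by (rule finite_subset[of _ "Pow ?P"]) auto
  then obtain h where h: "bij_betw h {..<card \<T>} \<T>"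
    using ex_bij_betw_nat_finite lessThan_atLeast0 by metis
  have "s \<le> s * s * s" by simp
  then have "{..<s} \<in> \<T>" by (auto simp: \<T>_def)
  then have R: "card \<T> \<ge> 1" using fin\<T> by (metis card_0_eq empty_iff less_one not_le)
  \<comment> \<open>\<open>m\<close> exceeds \<open>s * t\<close>: if \<open>m\<close> vertices
    receive only \<open>s\<close> colours, some colour occurs more than \<open>t\<close>
    times.\<close>
  define m where "m = s * t + 1"
  define M where "M = card \<T> * m"
  have M: "M \<ge> 1" using R by (simp add: M_def m_def)
  \<comment> \<open>With at most a quarter of \<open>U\<close> in \<open>B\<close> and at most a
    quarter exceptional, \<open>W\<close> below keeps half of \<open>U\<close> and so outnumbers
    \<open>B\<close>.\<close>
  obtain D where D: "\<forall>(U :: 'a set) S. finite U \<and> (\<forall>v\<in>U. S v \<subseteq> U \<and> D \<le> card (S v)) \<longrightarrow>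
    (\<exists>B f. B \<subseteq> U \<and> 4 * card B \<le> card U \<and> f ` B \<subseteq> {..<M} \<and>
       4 * card {v \<in> U. \<not> {..<M} \<subseteq> f ` (S v \<inter> B)} \<le> card U)"
    using ex_sparse_labelled_set[OF _ M, of 4, where ?'a='a] by auto
  show ?thesis
  proof (intro exI[of _ D] allI impI, elim conjE)
    fix U :: "'a set" and S
    assume fin: "finite U" and ne: "U \<noteq> {}" and S: "\<forall>v\<in>U. S v \<subseteq> U \<and> D \<le> card (S v)"
    obtain B f where B: "B \<subseteq> U" "4 * card B \<le> card U" and f: "f ` B \<subseteq> {..<M}"
      and bad: "4 * card {v \<in> U. \<not> {..<M} \<subseteq> f ` (S v \<inter> B)} \<le> card U"
      using D[THEN spec, THEN spec, THEN mp, OF conjI[OF fin S]] by blast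
    have finB: "finite B" using B fin finite_subset by blast
    \<comment> \<open>The \<open>m\<close> consecutive labels from \<open>k * m\<close> on all stand
      for the \<open>k\<close>-th \<open>s\<close>-subset, so a vertex seeing every label sees every
      \<open>s\<close>-subset as a list at least \<open>m\<close> times.\<close>
    define LB where "LB b = h (f b div m)" for b
    have LB: "LB b \<in> \<T>" if "b \<in> B" for b
    proof -
      have "f b < card \<T> * m" using f that by (auto simp: M_def)
      then have "f b div m < card \<T>" by (simp add: less_mult_imp_div_less)
      then show ?thesis using h by (auto simp: LB_def bij_betw_def)
    qed
    define W where "W = {v \<in> U. {..<M} \<subseteq> f ` (S v \<inter> B)} - B"
    have finW: "finite W" using fin by (simp add: W_def)
    have "card U = card {v \<in> U. {..<M} \<subseteq> f ` (S v \<inter> B)} + card {v \<in> U. \<not> {..<M} \<subseteq> f ` (S v \<inter> B)}"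
      using card_filter_add[OF fin] by simp
    moreover have "card {v \<in> U. {..<M} \<subseteq> f ` (S v \<inter> B)} \<le> card W + card B"
      unfolding W_def using diff_card_le_card_Diff[OF finB] le_diff_conv by blast
    moreover have "card U > 0" using fin ne by (simp add: card_gt_0_iff)
    ultimately have BW: "card B < card W" using B bad by linarith
    have many: "m \<le> card {b \<in> S v \<inter> B. LB b = T}" if v: "v \<in> W" and T: "T \<in> \<T>" for v T
    proof -
      obtain k where k: "k < card \<T>" "h k = T"
        using h T by (metis bij_betw_iff_bijections lessThan_iff)
      have "{k * m..<k * m + m} \<subseteq> f ` {b \<in> S v \<inter> B. LB b = T}"
      proof
        fix i assume i: "i \<in> {k * m..<k * m + m}"
        have "k * m + m \<le> M" unfolding M_def using k mult_right_mono[of "Suc k" "card \<T>" m] by simp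
        then have "i \<in> f ` (S v \<inter> B)" using v i by (auto simp: W_def)
        then obtain b where b: "b \<in> S v \<inter> B" "f b = i" by auto
        have "i div m = k" using i by (intro div_nat_eqI) (auto simp: mult.commute)
        then have "LB b = T" using b k by (simp add: LB_def)
        then show "i \<in> f ` {b \<in> S v \<inter> B. LB b = T}" using b by auto
      qed
      then have "card {k * m..<k * m + m} \<le> card {b \<in> S v \<inter> B. LB b = T}"
        using finB by (intro surj_card_le) auto
      then show ?thesis by simp
    qed
    define X where "X c v = {j. j < s * s \<and> (\<exists>x\<in>{j * s..<j * s + s}. card {u \<in> S v \<inter> B. c u = x} \<le> t)}" for c v
    define Y where "Y = (\<Pi>\<^sub>E b\<in>B. LB b)"
    have finY: "finite Y" unfolding Y_def using finB LB
      by (intro finite_PiE) (auto simp: \<T>_def dest: finite_subset)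
    have cardY: "card Y = s ^ card B"
      unfolding Y_def using finB LB by (simp add: card_PiE \<T>_def)
    \<comment> \<open>Otherwise one harmless colour from each of \<open>s\<close> blocks gives an
      \<open>s\<close>-subset; at least \<open>m\<close> neighbours of \<open>v\<close> carry it as
      list and use only these colours, each at most \<open>t\<close> times, contradicting
      \<open>m > s * t\<close>.\<close>
    have X: "card (X c v \<inter> {..<s * s}) \<le> s" if c: "c \<in> Y" and v: "v \<in> W" for c v
    proof (rule ccontr)
      assume "\<not> ?thesis"
      then have "s \<le> card (X c v)" by (simp add: X_def Collect_conj_eq Int_commute lessThan_def)
      then obtain J where J: "J \<subseteq> X c v" "card J = s" using obtain_subset_with_card_n by metis
      have finJ: "finite J" using J(2) s by (intro card_ge_0_finite) simp
      have "\<forall>j\<in>J. \<exists>x. x \<in> {j * s..<j * s + s} \<and> card {u \<in> S v \<inter> B. c u = x} \<le> t"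
        using J(1) unfolding X_def by blast
      then obtain x where x: "\<And>j. j \<in> J \<Longrightarrow> x j \<in> {j * s..<j * s + s}"
        "\<And>j. j \<in> J \<Longrightarrow> card {u \<in> S v \<inter> B. c u = x j} \<le> t" by metis
      have "x j div s = j" if "j \<in> J" for j
        using x(1)[OF that] by (intro div_nat_eqI) (auto simp: mult.commute)
      then have "inj_on x J" by (metis inj_onI)
      then have card: "card (x ` J) = s" using J by (simp add: card_image)
      have "x j < s * s * s" if "j \<in> J" for j
      proof -
        have "Suc j \<le> s * s" using J that by (auto simp: X_def)
        then have "j * s + s \<le> s * s * s" using mult_right_mono[of "Suc j" "s * s" s] by simp
        then show ?thesis using x(1)[OF that] by auto
      qed
      then have "x ` J \<in> \<T>" using card by (auto simp: \<T>_def)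
      then have "m \<le> card {b \<in> S v \<inter> B. LB b = x ` J}" using many[OF v] by blast
      also have "\<dots> \<le> card (\<Union>j\<in>J. {u \<in> S v \<inter> B. c u = x j})"
        using c finB finJ by (intro card_mono) (auto simp: Y_def PiE_iff)
      also have "\<dots> \<le> (\<Sum>j\<in>J. card {u \<in> S v \<inter> B. c u = x j})"
        using finJ by (rule card_UN_le)
      also have "\<dots> \<le> (\<Sum>j\<in>J. t)" using x(2) by (intro sum_mono) auto
      finally show False using J(2) by (simp add: m_def)
    qed
    obtain F where F: "s ^ card W * card {c \<in> Y. \<forall>v\<in>W. F v \<in> X c v} \<le> card Y" "\<forall>v. F v < s * s"
      using ex_choice_defeating_all[where X = X and Y = Y, OF finW finY _ X] s by auto
    \<comment> \<open>Because \<open>B\<close> is smaller than \<open>W\<close>, at most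
      \<open>s ^ card B / s ^ card W < 1\<close> colourings of \<open>B\<close> survive.\<close>
    have "card Y < s ^ card W" unfolding cardY using BW s by (intro power_strict_increasing) auto
    then have "card {c \<in> Y. \<forall>v\<in>W. F v \<in> X c v} = 0"
      using F(1) by (cases "card {c \<in> Y. \<forall>v\<in>W. F v \<in> X c v}") auto
    then have F_kills: "\<exists>v\<in>W. F v \<notin> X c v" if "c \<in> Y" for c using finY that by auto
    \<comment> \<open>Outside \<open>B\<close> the list is the block picked by \<open>F\<close>.
      Every colouring of \<open>B\<close> makes all colours of that block frequent around some
      \<open>v\<close> in \<open>W\<close>.\<close>
    define L where "L v = (if v \<in> B then LB v else {F v * s..<F v * s + s})" for v
    have "\<forall>v. finite (L v) \<and> card (L v) = s"
      using LB s by (auto simp: L_def \<T>_def dest: finite_subset)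
    moreover have "\<exists>v\<in>U. t < card {u \<in> S v. c u = c v}" if c: "\<forall>v\<in>U. c v \<in> L v" for c
    proof -
      have "c b \<in> LB b" if "b \<in> B" for b using c B that by (auto simp: L_def dest: bspec[of U _ b])
      then have "restrict c B \<in> Y" by (auto simp: Y_def)
      then obtain v where v: "v \<in> W" "F v \<notin> X (restrict c B) v" using F_kills by blast
      have vU: "v \<in> U" and vB: "v \<notin> B" using v by (auto simp: W_def)
      then have "c v \<in> {F v * s..<F v * s + s}" using c by (force simp: L_def)
      then have "t < card {u \<in> S v \<inter> B. restrict c B u = c v}"
        using v F(2) by (auto simp: X_def not_le)
      also have "\<dots> \<le> card {u \<in> S v. c u = c v}"
        using S vU fin by (intro card_mono) (auto intro: finite_subset)
      finally show ?thesis using vU by blast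
    qed
    ultimately show "\<exists>L :: 'a \<Rightarrow> nat set. (\<forall>v. finite (L v) \<and> card (L v) = s) \<and>
       (\<forall>c. (\<forall>v\<in>U. c v \<in> L v) \<longrightarrow> (\<exists>v\<in>U. t < card {u \<in> S v. c u = c v}))" by blast
  qed
qed

section \<open>Graphs without dense 1-subdivisions\<close>

text \<open>
  The data \<open>U, W, g\<close> encode a 1-subdivision in \<open>G\<close>: the edge \<open>g w\<close> of a graph on \<open>U\<close> is
  subdivided by \<open>w\<close>.
\<close>

definition pair_degenerate :: "'a pair_pre_digraph \<Rightarrow> nat \<Rightarrow> bool" where
  "pair_degenerate G d \<longleftrightarrow> (\<forall>U W (g :: 'a \<Rightarrow> 'a set).
     U \<subseteq> pverts G \<and> U \<noteq> {} \<and> W \<subseteq> pverts G - U \<and> inj_on g W \<and>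
     (\<forall>w\<in>W. g w \<subseteq> neighbors G w \<inter> U \<and> card (g w) = 2) \<longrightarrow>
     (\<exists>u\<in>U. card {w \<in> W. u \<in> g w} < d))"

lemma pair_degenerateD:
  assumes "pair_degenerate G d" "U \<subseteq> pverts G" "U \<noteq> {}" "W \<subseteq> pverts G - U" "inj_on g W"
    and "\<And>w. w \<in> W \<Longrightarrow> g w \<subseteq> neighbors G w \<inter> U \<and> card (g w) = 2"
  obtains u where "u \<in> U" "card {w \<in> W. u \<in> g w} < d"
  using assms unfolding pair_degenerate_def by meson

lemma pair_graph_finite: "pair_graph G \<Longrightarrow> finite (pverts G)"
  by (simp add: pair_graph_def pair_digraph_def pair_fin_digraph_def pair_fin_digraph_axioms_def)

lemma neighbors_subset: "pair_graph G \<Longrightarrow> neighbors G v \<subseteq> pverts G"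
  by (auto simp: neighbors_def pair_graph_def pair_digraph_def pair_fin_digraph_def
      intro: pair_wf_digraph.in_arcsD2)

lemma neighbors_sym: "pair_graph G \<Longrightarrow> u \<in> neighbors G v \<longleftrightarrow> v \<in> neighbors G u"
proof -
  assume "pair_graph G"
  then interpret pair_graph G .
  show ?thesis using pair_sym_arcs by (auto simp: neighbors_def symmetric_def dest: symD)
qed

lemma neighbors_irrefl: "pair_graph G \<Longrightarrow> v \<notin> neighbors G v"
proof -
  assume "pair_graph G"
  then interpret pair_graph G .
  show ?thesis using pair_no_loops[of "(v, v)"] by (auto simp: neighbors_def)
qed

lemma finite_neighbors: "pair_graph G \<Longrightarrow> finite (neighbors G v)"
  using neighbors_subset pair_graph_finite finite_subset by metis

text \<open>The edge count of a degenerate graph: repeatedly delete a vertex of \<open>U\<close>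
  lying in fewer than \<open>d\<close> pairs, together with the elements of \<open>W\<close> whose
  pairs contain it.\<close>

lemma pair_degenerate_card:
  assumes G: "pair_graph G" and d: "pair_degenerate G d"
    and "U \<subseteq> pverts G" "W \<subseteq> pverts G - U" "inj_on g W"
    and "\<And>w. w \<in> W \<Longrightarrow> g w \<subseteq> neighbors G w \<inter> U \<and> card (g w) = 2"
  shows "card W \<le> d * card U"
  using assms(3-)
proof (induction "card U" arbitrary: U W)
  case 0
  then have "U = {}" using pair_graph_finite[OF G] by (metis card_0_eq finite_subset)
  then have "W = {}" using 0 by fastforce
  then show ?case by simp
next
  case (Suc n)
  then have finU: "finite U" and ne: "U \<noteq> {}" by (auto intro: card_ge_0_finite)
  have finW: "finite W" using Suc.prems(2) pair_graph_finite[OF G] finite_subset by blast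
  obtain u where u: "u \<in> U" "card {w \<in> W. u \<in> g w} < d"
    using pair_degenerateD[OF d Suc.prems(1) ne Suc.prems(2,3,4)] by blast
  let ?W = "{w \<in> W. u \<notin> g w}"
  have "card ?W \<le> d * card (U - {u})"
  proof (rule Suc.hyps(1))
    show "n = card (U - {u})" using Suc.hyps(2) u finU by simp
    show "U - {u} \<subseteq> pverts G" "?W \<subseteq> pverts G - (U - {u})" using Suc.prems by auto
    show "inj_on g ?W" using Suc.prems(3) by (rule inj_on_subset) auto
    show "g w \<subseteq> neighbors G w \<inter> (U - {u}) \<and> card (g w) = 2" if "w \<in> ?W" for w
      using that Suc.prems(4)[of w] by auto
  qed
  moreover have "card W = card ?W + card {w \<in> W. u \<in> g w}"
    using card_filter_add[OF finW, of "\<lambda>w. u \<in> g w"] by simp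
  ultimately have "card W \<le> d * card (U - {u}) + d" using u by linarith
  also have "\<dots> = d * card U" by (subst card.remove[OF finU u(1)]) simp
  finally show ?case .
qed

text \<open>Were every pair inside \<open>K\<close> already used, \<open>W\<close> would subdivide
  the complete graph on \<open>K\<close>, whose degrees \<open>card K - 1\<close> are at least
  \<open>d\<close>.\<close>

lemma pair_degenerate_ex_new_pair:
  assumes G: "pair_graph G" and d: "pair_degenerate G d"
    and W: "W \<subseteq> pverts G" "inj_on g W" "\<And>w. w \<in> W \<Longrightarrow> g w \<subseteq> neighbors G w \<and> card (g w) = 2"
    and K: "K \<subseteq> pverts G - W" "d < card K"
  shows "\<exists>e. e \<subseteq> K \<and> card e = 2 \<and> e \<notin> g ` W"
proof (rule ccontr)
  assume contra: "\<not> ?thesis"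
  let ?W = "{w \<in> W. g w \<subseteq> K}"
  have finW: "finite W" using W(1) pair_graph_finite[OF G] finite_subset by blast
  have finK: "finite K" using K pair_graph_finite[OF G] finite_subset by blast
  obtain u where u: "u \<in> K" "card {w \<in> ?W. u \<in> g w} < d"
  proof (rule pair_degenerateD[OF d, of K ?W g])
    show "K \<noteq> {}" using K by auto
    show "inj_on g ?W" using W(2) by (rule inj_on_subset) auto
  qed (use K W in auto)
  have "(\<lambda>v. {u, v}) ` (K - {u}) \<subseteq> g ` {w \<in> ?W. u \<in> g w}"
  proof
    fix e assume "e \<in> (\<lambda>v. {u, v}) ` (K - {u})"
    then obtain v where "v \<in> K" "v \<noteq> u" "e = {u, v}" by auto
    then have e: "e \<subseteq> K" "card e = 2" "u \<in> e" using u by auto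
    then have "e \<in> g ` W" using contra by blast
    then show "e \<in> g ` {w \<in> ?W. u \<in> g w}" using e by auto
  qed
  then have "card ((\<lambda>v. {u, v}) ` (K - {u})) \<le> card {w \<in> ?W. u \<in> g w}"
    using finW by (intro surj_card_le) auto
  moreover have "card ((\<lambda>v. {u, v}) ` (K - {u})) = card (K - {u})"
    by (intro card_image) (auto simp: inj_on_def doubleton_eq_iff)
  ultimately show False using u K finK by simp
qed

lemma pair_degenerate_choose_pairs:
  assumes G: "pair_graph G" and d: "pair_degenerate G d"
    and A: "A \<subseteq> pverts G" and W: "W \<subseteq> pverts G - A"
    and large: "\<And>w. w \<in> W \<Longrightarrow> d < card (neighbors G w \<inter> A)"
  shows "\<exists>g. inj_on g W \<and> (\<forall>w\<in>W. g w \<subseteq> neighbors G w \<inter> A \<and> card (g w) = 2)"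
proof -
  have "finite W" using W pair_graph_finite[OF G] finite_subset by blast
  then show ?thesis using W large
  proof (induction W rule: finite_induct)
    case empty
    then show ?case by simp
  next
    case (insert w W)
    then obtain g where g: "inj_on g W" "\<forall>w\<in>W. g w \<subseteq> neighbors G w \<inter> A \<and> card (g w) = 2" by blast
    have "\<exists>e. e \<subseteq> neighbors G w \<inter> A \<and> card e = 2 \<and> e \<notin> g ` W"
    proof (rule pair_degenerate_ex_new_pair[OF G d _ g(1)])
      show "W \<subseteq> pverts G" "neighbors G w \<inter> A \<subseteq> pverts G - W" using A insert.prems(1) by blast+
      show "d < card (neighbors G w \<inter> A)" using insert.prems(2) by simp
      show "g v \<subseteq> neighbors G v \<and> card (g v) = 2" if "v \<in> W" for v using g(2) that by blast
    qed
    then obtain e where e: "e \<subseteq> neighbors G w \<inter> A" "card e = 2" "e \<notin> g ` W" by blast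
    have "inj_on (g(w := e)) W" using g(1) e(3) by (rule inj_on_fun_updI)
    moreover have "(g(w := e)) w \<notin> (g(w := e)) ` (W - {w})" using e(3) insert.hyps by auto
    ultimately have "inj_on (g(w := e)) (insert w W)" unfolding inj_on_insert ..
    moreover have "\<forall>v\<in>insert w W. (g(w := e)) v \<subseteq> neighbors G v \<inter> A \<and> card ((g(w := e)) v) = 2"
      using g(2) e insert.hyps by auto
    ultimately show ?case by (intro exI[of _ "g(w := e)"] conjI)
  qed
qed

text \<open>If all degrees inside \<open>U\<close> are large, most of \<open>U\<close> has more than
  \<open>d\<close> neighbours in a sparse set \<open>A\<close>. Distinct pairs in \<open>A\<close>
  show that there are at most \<open>d * card A\<close> such vertices outside \<open>A\<close>, too
  few to fill \<open>U\<close>.\<close>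

lemma pair_degenerate_imp_degenerate:
  "\<exists>d'. \<forall>(G :: 'a pair_pre_digraph). pair_graph G \<and> pair_degenerate G d \<longrightarrow>
    (\<forall>U. U \<subseteq> pverts G \<and> U \<noteq> {} \<longrightarrow> (\<exists>u\<in>U. card (neighbors G u \<inter> U) < d'))"
proof -
  \<comment> \<open>The ratio \<open>4 * d + 4\<close> makes \<open>card W + card A\<close>, at most
    \<open>(d + 1) * card A\<close>, at most a quarter of \<open>card U\<close>, whereas it should
    reach three quarters. Seeing \<open>d + 1\<close> labels means having more than \<open>d\<close>
    neighbours in \<open>A\<close>.\<close>
  have "1 \<le> 4 * d + 4" "1 \<le> d + 1" by simp_all
  from ex_sparse_labelled_set[OF this, where ?'a='a]
  obtain D where D: "\<forall>(U :: 'a set) S. finite U \<and> (\<forall>v\<in>U. S v \<subseteq> U \<and> D \<le> card (S v)) \<longrightarrow>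
    (\<exists>B f. B \<subseteq> U \<and> (4 * d + 4) * card B \<le> card U \<and> f ` B \<subseteq> {..<d + 1} \<and>
       4 * card {v \<in> U. \<not> {..<d + 1} \<subseteq> f ` (S v \<inter> B)} \<le> card U)" by (rule exE)
  show ?thesis
  proof (intro exI[of _ D] allI impI, elim conjE, rule ccontr)
    fix G :: "'a pair_pre_digraph" and U
    assume G: "pair_graph G" and d: "pair_degenerate G d" and U: "U \<subseteq> pverts G" "U \<noteq> {}"
      and "\<not> (\<exists>u\<in>U. card (neighbors G u \<inter> U) < D)"
    then have deg: "\<forall>v\<in>U. neighbors G v \<inter> U \<subseteq> U \<and> D \<le> card (neighbors G v \<inter> U)" by (auto simp: not_less)
    have fin: "finite U" using U pair_graph_finite[OF G] finite_subset by blast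
    obtain A f where A: "A \<subseteq> U" "(4 * d + 4) * card A \<le> card U"
      and bad: "4 * card {v \<in> U. \<not> {..<d + 1} \<subseteq> f ` (neighbors G v \<inter> U \<inter> A)} \<le> card U"
      using D[THEN spec, THEN spec, THEN mp, OF conjI[OF fin deg]] by blast
    have finA: "finite A" using A fin finite_subset by blast
    define W where "W = {v \<in> U. {..<d + 1} \<subseteq> f ` (neighbors G v \<inter> U \<inter> A)} - A"
    have "card U = card {v \<in> U. {..<d + 1} \<subseteq> f ` (neighbors G v \<inter> U \<inter> A)}
        + card {v \<in> U. \<not> {..<d + 1} \<subseteq> f ` (neighbors G v \<inter> U \<inter> A)}"
      using card_filter_add[OF fin] by simp
    moreover have "card {v \<in> U. {..<d + 1} \<subseteq> f ` (neighbors G v \<inter> U \<inter> A)} \<le> card W + card A"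
      unfolding W_def using diff_card_le_card_Diff[OF finA] le_diff_conv by blast
    moreover have "card U > 0" using fin U by (simp add: card_gt_0_iff)
    moreover have WA: "W \<subseteq> pverts G - A" using U by (auto simp: W_def)
    have "\<exists>g. inj_on g W \<and> (\<forall>w\<in>W. g w \<subseteq> neighbors G w \<inter> A \<and> card (g w) = 2)"
    proof (rule pair_degenerate_choose_pairs[OF G d _ WA])
      show "A \<subseteq> pverts G" using A U by blast
      fix w assume "w \<in> W"
      then have "{..<d + 1} \<subseteq> f ` (neighbors G w \<inter> A)" by (auto simp: W_def)
      then have "card {..<d + 1} \<le> card (neighbors G w \<inter> A)"
        using finA by (intro surj_card_le) auto
      then show "d < card (neighbors G w \<inter> A)" by simp
    qed
    then have "card W \<le> d * card A"
      using pair_degenerate_card[OF G d _ WA] A U by blast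
    ultimately show False using A(2) bad by (simp add: algebra_simps)
  qed
qed

section \<open>Constructing an arrangement\<close>

lemma card_eq_sum_fibers:
  assumes "finite A"
  shows "card A = (\<Sum>y\<in>f ` A. card {x \<in> A. f x = y})"
  using sum.image_gen[OF assms, of "\<lambda>_. 1 :: nat" f] by simp

text \<open>Deleting a vertex of degree below \<open>d\<close> lowers the degree sum by twice its
  degree, once at the vertex and once over its neighbours.\<close>

lemma sum_degree_le:
  assumes G: "pair_graph G"
    and deg: "\<And>U. U \<subseteq> pverts G \<Longrightarrow> U \<noteq> {} \<Longrightarrow> \<exists>u\<in>U. card (neighbors G u \<inter> U) < d"
    and "U \<subseteq> pverts G"
  shows "(\<Sum>u\<in>U. card (neighbors G u \<inter> U)) \<le> 2 * d * card U"
  using assms(3)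
proof (induction "card U" arbitrary: U)
  case 0
  then have "U = {}" using pair_graph_finite[OF G] by (metis card_0_eq finite_subset)
  then show ?case by simp
next
  case (Suc n)
  then have fin: "finite U" and ne: "U \<noteq> {}" by (auto intro: card_ge_0_finite)
  obtain x where x: "x \<in> U" "card (neighbors G x \<inter> U) < d" using deg[OF Suc.prems ne] by blast
  let ?U = "U - {x}"
  have split: "card (neighbors G u \<inter> U) = card (neighbors G u \<inter> ?U) + of_bool (u \<in> neighbors G x)"
    if "u \<in> ?U" for u
  proof (cases "x \<in> neighbors G u")
    case True
    then have "neighbors G u \<inter> U = insert x (neighbors G u \<inter> ?U)" using x by auto
    then show ?thesis using True fin neighbors_sym[OF G] by simp
  next
    case False
    then have "neighbors G u \<inter> U = neighbors G u \<inter> ?U" by auto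
    then show ?thesis using False neighbors_sym[OF G] by simp
  qed
  have "(\<Sum>u\<in>U. card (neighbors G u \<inter> U))
      = card (neighbors G x \<inter> U) + (\<Sum>u\<in>?U. card (neighbors G u \<inter> U))"
    using fin x by (simp add: sum.remove)
  also have "(\<Sum>u\<in>?U. card (neighbors G u \<inter> U))
      = (\<Sum>u\<in>?U. card (neighbors G u \<inter> ?U) + of_bool (u \<in> neighbors G x))"
    using split by (rule sum.cong[OF refl])
  also have "\<dots> = (\<Sum>u\<in>?U. card (neighbors G u \<inter> ?U)) + card (?U \<inter> neighbors G x)"
    using fin by (simp add: sum.distrib)
  also have "(\<Sum>u\<in>?U. card (neighbors G u \<inter> ?U)) \<le> 2 * d * card ?U"
    using Suc.hyps(2) Suc.prems fin x by (intro Suc.hyps(1)) auto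
  also have "card (?U \<inter> neighbors G x) \<le> card (neighbors G x \<inter> U)"
    using fin by (intro card_mono) auto
  finally have "(\<Sum>u\<in>U. card (neighbors G u \<inter> U)) \<le> 2 * d * card ?U + 2 * d" using x by simp
  also have "\<dots> = 2 * d * card U" by (subst card.remove[OF fin x(1)]) simp
  finally show ?case .
qed

text \<open>Markov's inequality: the average is at most \<open>2 * d\<close>, so at most half of
  \<open>U\<close> exceeds \<open>4 * d\<close>.\<close>

lemma half_low_degree:
  assumes fin: "finite U" and sum: "(\<Sum>u\<in>U. f u) \<le> 2 * d * card U" and d: "d \<ge> 1"
  shows "card U \<le> 2 * card {u \<in> U. f u \<le> 4 * d}"
proof -
  have "2 * d * (2 * card {u \<in> U. \<not> f u \<le> 4 * d}) = (\<Sum>u\<in>{u \<in> U. \<not> f u \<le> 4 * d}. 4 * d)" by simp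
  also have "\<dots> \<le> (\<Sum>u\<in>{u \<in> U. \<not> f u \<le> 4 * d}. f u)" by (intro sum_mono) auto
  also have "\<dots> \<le> (\<Sum>u\<in>U. f u)" using fin by (intro sum_mono2) auto
  finally have "2 * d * (2 * card {u \<in> U. \<not> f u \<le> 4 * d}) \<le> 2 * d * card U"
    using sum by (rule order_trans)
  then have "2 * card {u \<in> U. \<not> f u \<le> 4 * d} \<le> card U" using d by simp
  then show ?thesis using card_filter_add[OF fin, of "\<lambda>u. f u \<le> 4 * d"] by linarith
qed

text \<open>Here \<open>U\<close> is still to be placed and all other vertices come later. If
  \<open>v\<close> is placed last within \<open>U\<close>, these are the vertices counted for
  \<open>v\<close> in the arrangeability.\<close>

abbreviation linked_outside :: "'a pair_pre_digraph \<Rightarrow> 'a set \<Rightarrow> 'a \<Rightarrow> 'a set" where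
  "linked_outside G U v \<equiv> {u \<in> U. u \<noteq> v \<and> neighbors G u \<inter> neighbors G v - U \<noteq> {}}"

text \<open>Charge each pair to a common neighbour \<open>h e\<close> outside \<open>U\<close>. One
  centre is charged for at most \<open>\<delta> * \<delta>\<close> pairs, and one selected pair per
  used centre gives an injective system, so there are at most \<open>d * card U\<close>
  centres.\<close>

lemma card_linked_pairs_le:
  assumes G: "pair_graph G" and d: "pair_degenerate G d" and U: "U \<subseteq> pverts G"
    and outer: "\<And>w. w \<in> pverts G - U \<Longrightarrow> card (neighbors G w \<inter> U) \<le> \<delta>"
    and E: "\<And>e. e \<in> E \<Longrightarrow> e \<subseteq> U \<and> card e = 2 \<and> (\<exists>w\<in>pverts G - U. e \<subseteq> neighbors G w)"
  shows "card E \<le> \<delta> * \<delta> * (d * card U)"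
proof -
  have fin: "finite U" using U pair_graph_finite[OF G] finite_subset by blast
  have finE: "finite E" using E fin by (intro finite_subset[of E "Pow U"]) auto
  obtain h where h: "\<And>e. e \<in> E \<Longrightarrow> h e \<in> pverts G - U \<and> e \<subseteq> neighbors G (h e)"
    using E by metis
  have fiber: "card {e \<in> E. h e = w} \<le> \<delta> * \<delta>" if "w \<in> h ` E" for w
  proof -
    let ?N = "neighbors G w \<inter> U"
    have "{e \<in> E. h e = w} \<subseteq> (\<lambda>(x, y). {x, y}) ` (?N \<times> ?N)"
    proof
      fix e assume e: "e \<in> {e \<in> E. h e = w}"
      then obtain x y where "e = {x, y}" using E[of e] by (auto simp: card_2_iff)
      then show "e \<in> (\<lambda>(x, y). {x, y}) ` (?N \<times> ?N)" using e h[of e] E[of e] by auto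
    qed
    then have "card {e \<in> E. h e = w} \<le> card (?N \<times> ?N)" using fin by (intro surj_card_le) auto
    also have "\<dots> \<le> \<delta> * \<delta>" using outer[of w] that h by (auto simp: card_cartesian_product intro!: mult_mono)
    finally show ?thesis .
  qed
  have "card E = (\<Sum>w\<in>h ` E. card {e \<in> E. h e = w})"
    using finE by (rule card_eq_sum_fibers)
  also have "\<dots> \<le> (\<Sum>w\<in>h ` E. \<delta> * \<delta>)" using fiber by (rule sum_mono)
  also have "\<dots> = \<delta> * \<delta> * card (h ` E)" by simp
  also have "card (h ` E) \<le> d * card U"
  proof (rule pair_degenerate_card[OF G d U])
    show "h ` E \<subseteq> pverts G - U" using h by blast
    show "inj_on (inv_into E h) (h ` E)" by (simp add: inj_on_inv_into)
    fix w assume w: "w \<in> h ` E"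
    then have "inv_into E h w \<in> E" "h (inv_into E h w) = w" by (auto intro: inv_into_into f_inv_into_f)
    then show "inv_into E h w \<subseteq> neighbors G w \<inter> U \<and> card (inv_into E h w) = 2"
      using h E by (metis Int_subset_iff)
  qed
  finally show ?thesis by simp
qed

text \<open>At least half of \<open>U\<close> has low degree, and linked pairs are few on average,
  so some low-degree vertex has few partners. Its low degree preserves the bound on outer vertices
  once it leaves \<open>U\<close>.\<close>

lemma ex_next_vertex:
  assumes G: "pair_graph G" and d: "pair_degenerate G d" and d': "d' \<ge> 1"
    and deg: "\<And>U. U \<subseteq> pverts G \<Longrightarrow> U \<noteq> {} \<Longrightarrow> \<exists>u\<in>U. card (neighbors G u \<inter> U) < d'"
    and U: "U \<subseteq> pverts G" "U \<noteq> {}"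
    and outer: "\<And>w. w \<in> pverts G - U \<Longrightarrow> card (neighbors G w \<inter> U) \<le> 4 * d'"
  shows "\<exists>v\<in>U. card (neighbors G v \<inter> U) \<le> 4 * d' \<and> card (linked_outside G U v) \<le> 64 * d' * d' * d"
proof (rule ccontr)
  assume contra: "\<not> ?thesis"
  \<comment> \<open>\<open>(4 * d') * (4 * d') * d\<close> bounds the pairs per vertex of
    \<open>U\<close>; a factor 2 comes from the two orientations of a pair and another from passing
    to the low-degree half.\<close>
  let ?k = "64 * d' * d' * d"
  have fin: "finite U" using U pair_graph_finite[OF G] finite_subset by blast
  define U' where "U' = {v \<in> U. card (neighbors G v \<inter> U) \<le> 4 * d'}"
  have half: "card U \<le> 2 * card U'"
    unfolding U'_def using sum_degree_le[OF G deg U(1)] by (intro half_low_degree[OF fin _ d']) auto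
  have finU': "finite U'" using fin by (simp add: U'_def)
  let ?P = "Sigma U' (linked_outside G U)"
  have finP: "finite ?P" using fin finU' by (intro finite_SigmaI) auto
  define E where "E = (\<lambda>(v, u). {v, u}) ` ?P"
  have "card E \<le> 4 * d' * (4 * d') * (d * card U)"
  proof (rule card_linked_pairs_le[OF G d U(1) outer])
    fix e assume "e \<in> E"
    then obtain v u w where e: "e = {v, u}" "v \<in> U" "u \<in> U" "u \<noteq> v"
      and w: "w \<in> neighbors G u" "w \<in> neighbors G v" "w \<notin> U" by (auto simp: E_def U'_def)
    then have "w \<in> pverts G - U" "e \<subseteq> neighbors G w"
      using neighbors_subset[OF G] neighbors_sym[OF G] by blast+
    then show "e \<subseteq> U \<and> card e = 2 \<and> (\<exists>w\<in>pverts G - U. e \<subseteq> neighbors G w)" using e by auto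
  qed
  moreover have "card ?P \<le> 2 * card E"
  proof -
    have "card ?P = (\<Sum>e\<in>E. card {p \<in> ?P. (case p of (v, u) \<Rightarrow> {v, u}) = e})"
      unfolding E_def using finP by (rule card_eq_sum_fibers)
    also have "\<dots> \<le> (\<Sum>e\<in>E. 2)"
    proof (rule sum_mono)
      fix e assume "e \<in> E"
      then obtain v u where e: "e = {v, u}" by (auto simp: E_def)
      have "card {p \<in> ?P. (case p of (v, u) \<Rightarrow> {v, u}) = e} \<le> card {(v, u), (u, v)}"
        unfolding e by (intro card_mono) (auto simp: doubleton_eq_iff)
      also have "\<dots> \<le> 2" using card_length[of "[(v, u), (u, v)]"] by simp
      finally show "card {p \<in> ?P. (case p of (v, u) \<Rightarrow> {v, u}) = e} \<le> 2" .
    qed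
    finally show ?thesis by simp
  qed
  moreover have "card U' * Suc ?k \<le> card ?P"
  proof -
    have "card U' * Suc ?k = (\<Sum>v\<in>U'. Suc ?k)" by simp
    also have "\<dots> \<le> (\<Sum>v\<in>U'. card (linked_outside G U v))"
      using contra by (intro sum_mono) (auto simp: U'_def not_le Suc_le_eq)
    also have "\<dots> = card ?P" using fin finU' by simp
    finally show ?thesis .
  qed
  ultimately have "card U' * Suc ?k \<le> ?k div 2 * card U" by (simp add: algebra_simps)
  also have "\<dots> \<le> ?k div 2 * (2 * card U')" using half by (rule mult_left_mono) simp
  also have "\<dots> = card U' * ?k" by simp
  finally have "card U' = 0" by simp
  then show False using half fin U by simp
qed

text \<open>Orders are represented by injective positions, which extend easily by a last vertex and
  directly drive greedy colourings.\<close>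

definition arranged :: "'a pair_pre_digraph \<Rightarrow> nat \<Rightarrow> ('a \<Rightarrow> nat) \<Rightarrow> bool" where
  "arranged G k p \<longleftrightarrow> inj_on p (pverts G) \<and>
     (\<forall>v\<in>pverts G. card {u \<in> pverts G. p u < p v \<and>
        (\<exists>w \<in> neighbors G u \<inter> neighbors G v. p v < p w)} \<le> k)"

text \<open>The order grows from its end: the vertex found in \<open>U\<close> receives the largest
  position, and the rest of \<open>U\<close> is ordered recursively.\<close>

lemma ex_arranged:
  fixes G :: "'a pair_pre_digraph"
  assumes G: "pair_graph G" and d: "pair_degenerate G d" and d': "d' \<ge> 1"
    and deg: "\<And>U. U \<subseteq> pverts G \<Longrightarrow> U \<noteq> {} \<Longrightarrow> \<exists>u\<in>U. card (neighbors G u \<inter> U) < d'"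
  shows "\<exists>p. arranged G (64 * d' * d' * d) p"
proof -
  let ?k = "64 * d' * d' * d" and ?V = "pverts G"
  \<comment> \<open>Vertices outside \<open>U\<close> count as later than all of \<open>U\<close>,
    hence the implication \<open>w \<in> U \<longrightarrow> p v < p w\<close>. The invariant is
    that they have at most \<open>4 * d'\<close> neighbours in \<open>U\<close>; for the full vertex
    set it is vacuous.\<close>
  have build: "\<exists>p :: 'a \<Rightarrow> nat. inj_on p U \<and> p ` U \<subseteq> {..<card U} \<and>
     (\<forall>v\<in>U. card {u \<in> U. p u < p v \<and>
        (\<exists>w \<in> neighbors G u \<inter> neighbors G v. w \<in> U \<longrightarrow> p v < p w)} \<le> ?k)"
    if "U \<subseteq> ?V" "\<And>w. w \<in> ?V - U \<Longrightarrow> card (neighbors G w \<inter> U) \<le> 4 * d'" for U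
    using that
  proof (induction "card U" arbitrary: U)
    case 0
    then have "U = {}" using pair_graph_finite[OF G] by (metis card_0_eq finite_subset)
    then show ?case by simp
  next
    case (Suc n)
    then have fin: "finite U" and ne: "U \<noteq> {}" by (auto intro: card_ge_0_finite)
    obtain v where v: "v \<in> U" "card (neighbors G v \<inter> U) \<le> 4 * d'" "card (linked_outside G U v) \<le> ?k"
      using ex_next_vertex[OF G d d' deg Suc.prems(1) ne Suc.prems(2)] by blast
    let ?U = "U - {v}"
    have card: "card U = Suc (card ?U)" using card.remove[OF fin v(1)] .
    have "\<exists>p. inj_on p ?U \<and> p ` ?U \<subseteq> {..<card ?U} \<and>
     (\<forall>v\<in>?U. card {u \<in> ?U. p u < p v \<and>
        (\<exists>w \<in> neighbors G u \<inter> neighbors G v. w \<in> ?U \<longrightarrow> p v < p w)} \<le> ?k)"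
    proof (rule Suc.hyps(1))
      show "n = card ?U" "?U \<subseteq> ?V" using card Suc.hyps(2) Suc.prems(1) by auto
      fix w assume w: "w \<in> ?V - ?U"
      have "card (neighbors G w \<inter> ?U) \<le> card (neighbors G w \<inter> U)" using fin by (intro card_mono) auto
      also have "\<dots> \<le> 4 * d'" using w v Suc.prems(2) by (cases "w = v") auto
      finally show "card (neighbors G w \<inter> ?U) \<le> 4 * d'" .
    qed
    then obtain p where p: "inj_on p ?U" "p ` ?U \<subseteq> {..<card ?U}"
      "\<And>x. x \<in> ?U \<Longrightarrow> card {u \<in> ?U. p u < p x \<and>
        (\<exists>w \<in> neighbors G u \<inter> neighbors G x. w \<in> ?U \<longrightarrow> p x < p w)} \<le> ?k" by blast
    \<comment> \<open>Positions on \<open>?U\<close> are below \<open>card ?U\<close>, so this value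
      puts \<open>v\<close> last.\<close>
    define p' where "p' x = (if x = v then card ?U else p x)" for x
    have less: "p x < card ?U" if "x \<in> U" "x \<noteq> v" for x using p(2) that by blast
    have "inj_on p' U"
    proof (rule inj_onI)
      fix x y assume "x \<in> U" "y \<in> U" "p' x = p' y"
      then show "x = y" using less[of x] less[of y] p(1) by (auto simp: p'_def inj_on_def split: if_splits)
    qed
    moreover have "p' ` U \<subseteq> {..<card U}" using less card by (auto simp: p'_def less_Suc_eq)
    moreover have "card {u \<in> U. p' u < p' x \<and>
        (\<exists>w \<in> neighbors G u \<inter> neighbors G x. w \<in> U \<longrightarrow> p' x < p' w)} \<le> ?k" if x: "x \<in> U" for x
    proof (cases "x = v")
      case True
      have "{u \<in> U. p' u < p' x \<and> (\<exists>w \<in> neighbors G u \<inter> neighbors G x. w \<in> U \<longrightarrow> p' x < p' w)}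
          \<subseteq> linked_outside G U v"
      proof
        fix u
        assume u: "u \<in> {u \<in> U. p' u < p' x \<and> (\<exists>w \<in> neighbors G u \<inter> neighbors G x. w \<in> U \<longrightarrow> p' x < p' w)}"
        then obtain w where w: "w \<in> neighbors G u" "w \<in> neighbors G x" "w \<in> U \<longrightarrow> p' x < p' w" by blast
        have "w \<notin> U" using w(3) less[of w] True by (auto simp: p'_def split: if_splits)
        then show "u \<in> linked_outside G U v" using u w True by auto
      qed
      then have "card {u \<in> U. p' u < p' x \<and> (\<exists>w \<in> neighbors G u \<inter> neighbors G x. w \<in> U \<longrightarrow> p' x < p' w)}
          \<le> card (linked_outside G U v)" using fin by (intro card_mono) auto
      then show ?thesis using v(3) by linarith
    next
      case False
      \<comment> \<open>The last vertex \<open>v\<close> is never an earlier \<open>u\<close>, and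
        as a common neighbour it counts as later under both \<open>p'\<close> and
        \<open>p\<close>.\<close>
      have "{u \<in> U. p' u < p' x \<and> (\<exists>w \<in> neighbors G u \<inter> neighbors G x. w \<in> U \<longrightarrow> p' x < p' w)}
          \<subseteq> {u \<in> ?U. p u < p x \<and> (\<exists>w \<in> neighbors G u \<inter> neighbors G x. w \<in> ?U \<longrightarrow> p x < p w)}"
        using False less[OF x] by (auto simp: p'_def)
      then have "card {u \<in> U. p' u < p' x \<and> (\<exists>w \<in> neighbors G u \<inter> neighbors G x. w \<in> U \<longrightarrow> p' x < p' w)}
          \<le> card {u \<in> ?U. p u < p x \<and> (\<exists>w \<in> neighbors G u \<inter> neighbors G x. w \<in> ?U \<longrightarrow> p x < p w)}"
        using fin by (intro card_mono) auto
      then show ?thesis using p(3)[of x] x False by simp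
    qed
    ultimately show ?case by blast
  qed
  have "card (neighbors G w \<inter> ?V) \<le> 4 * d'" if "w \<in> ?V - ?V" for w using that by simp
  from build[OF order_refl this] obtain p :: "'a \<Rightarrow> nat" where p: "inj_on p ?V" and
    k: "\<forall>v\<in>?V. card {u \<in> ?V. p u < p v \<and> (\<exists>w \<in> neighbors G u \<inter> neighbors G v. w \<in> ?V \<longrightarrow> p v < p w)} \<le> ?k"
    by blast
  have "{u \<in> ?V. p u < p v \<and> (\<exists>w \<in> neighbors G u \<inter> neighbors G v. w \<in> ?V \<longrightarrow> p v < p w)}
      = {u \<in> ?V. p u < p v \<and> (\<exists>w \<in> neighbors G u \<inter> neighbors G v. p v < p w)}" for v
    using neighbors_subset[OF G, of v] by blast
  then have "arranged G ?k p" using p k by (simp add: arranged_def)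
  then show ?thesis by blast
qed

lemma ex_arranged_bound:
  "\<exists>k. \<forall>(G :: 'a pair_pre_digraph). pair_graph G \<and> pair_degenerate G d \<longrightarrow> (\<exists>p. arranged G k p)"
proof -
  obtain d' where d': "\<forall>(G :: 'a pair_pre_digraph). pair_graph G \<and> pair_degenerate G d \<longrightarrow>
    (\<forall>U. U \<subseteq> pverts G \<and> U \<noteq> {} \<longrightarrow> (\<exists>u\<in>U. card (neighbors G u \<inter> U) < d'))"
    using pair_degenerate_imp_degenerate by (rule exE)
  have "\<exists>p. arranged G (64 * Suc d' * Suc d' * d) p"
    if "pair_graph G" "pair_degenerate G d" for G :: "'a pair_pre_digraph"
  proof (rule ex_arranged[OF that])
    fix U assume "U \<subseteq> pverts G" "U \<noteq> {}"
    then have "\<exists>u\<in>U. card (neighbors G u \<inter> U) < d'" using d' that by blast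
    then show "\<exists>u\<in>U. card (neighbors G u \<inter> U) < Suc d'" using less_SucI by blast
  qed simp
  then show ?thesis by blast
qed

section \<open>Position functions and linear orders\<close>

lemma arranged_imp_arrangeability_le:
  assumes "arranged G k p"
  shows "arrangeability G \<le> k"
  unfolding arrangeability_def
proof (rule Least_le, intro exI conjI)
  let ?r = "{(u, v). u \<in> pverts G \<and> v \<in> pverts G \<and> p u \<le> p v}"
  have inj: "inj_on p (pverts G)" using assms by (simp add: arranged_def)
  show "linear_order_on (pverts G) ?r"
    unfolding linear_order_on_def partial_order_on_def preorder_on_def
    using inj by (auto simp: refl_on_def trans_def antisym_def total_on_def inj_on_def)
  show "\<forall>v\<in>pverts G.
           card {u \<in> pverts G. (u, v) \<in> ?r \<and> u \<noteq> v \<and>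
                   (\<exists>w \<in> neighbors G u \<inter> neighbors G v. (v, w) \<in> ?r \<and> v \<noteq> w)} \<le> k"
  proof
    fix v assume v: "v \<in> pverts G"
    have fin: "finite {u \<in> pverts G. p u < p v \<and> (\<exists>w \<in> neighbors G u \<inter> neighbors G v. p v < p w)}"
      (is "finite ?A")
      using inj by (rule_tac inj_on_finite[of p _ "{..<p v}"]) (auto intro: inj_on_subset)
    have "p u < p v" if "u \<in> pverts G" "p u \<le> p v" "u \<noteq> v" for u
      using inj that v by (metis inj_onD le_neq_implies_less)
    moreover have "p v < p w" if "w \<in> pverts G" "p v \<le> p w" "v \<noteq> w" for w
      using inj that v by (metis inj_onD le_neq_implies_less)
    ultimately have "{u \<in> pverts G. (u, v) \<in> ?r \<and> u \<noteq> v \<and>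
                   (\<exists>w \<in> neighbors G u \<inter> neighbors G v. (v, w) \<in> ?r \<and> v \<noteq> w)} \<subseteq> ?A"
      by blast
    then have "card {u \<in> pverts G. (u, v) \<in> ?r \<and> u \<noteq> v \<and>
                   (\<exists>w \<in> neighbors G u \<inter> neighbors G v. (v, w) \<in> ?r \<and> v \<noteq> w)} \<le> card ?A"
      using fin by (rule card_mono[rotated])
    then show "card {u \<in> pverts G. (u, v) \<in> ?r \<and> u \<noteq> v \<and>
                   (\<exists>w \<in> neighbors G u \<inter> neighbors G v. (v, w) \<in> ?r \<and> v \<noteq> w)} \<le> k"
      using assms v unfolding arranged_def by (meson order_trans)
  qed
qed

text \<open>Take the number of strict predecessors as position: for \<open>u\<close> before
  \<open>v\<close>, the predecessors of \<open>v\<close> include those of \<open>u\<close> and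
  \<open>u\<close> itself.\<close>

lemma linear_order_on_position:
  assumes fin: "finite V" and r: "linear_order_on V r"
  shows "\<exists>p :: 'a \<Rightarrow> nat. inj_on p V \<and> (\<forall>u\<in>V. \<forall>v\<in>V. p u < p v \<longleftrightarrow> (u, v) \<in> r \<and> u \<noteq> v)"
proof -
  define p where "p v = card {u \<in> V. (u, v) \<in> r \<and> u \<noteq> v}" for v
  have refl: "refl_on V r" and trans: "trans r" and antisym: "antisym r" and total: "total_on V r"
    using r by (auto simp: linear_order_on_def partial_order_on_def preorder_on_def)
  have less: "p u < p v" if "(u, v) \<in> r" "u \<noteq> v" "u \<in> V" for u v
  proof -
    have "{w \<in> V. (w, u) \<in> r \<and> w \<noteq> u} \<subset> {w \<in> V. (w, v) \<in> r \<and> w \<noteq> v}"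
    proof
      show "{w \<in> V. (w, u) \<in> r \<and> w \<noteq> u} \<subseteq> {w \<in> V. (w, v) \<in> r \<and> w \<noteq> v}"
        using that trans antisym by (auto dest: transD antisymD)
      show "{w \<in> V. (w, u) \<in> r \<and> w \<noteq> u} \<noteq> {w \<in> V. (w, v) \<in> r \<and> w \<noteq> v}" using that by blast
    qed
    then show ?thesis unfolding p_def using fin by (intro psubset_card_mono) auto
  qed
  have "p u < p v \<longleftrightarrow> (u, v) \<in> r \<and> u \<noteq> v" if "u \<in> V" "v \<in> V" for u v
  proof
    assume "p u < p v"
    then have "u \<noteq> v" "(v, u) \<notin> r" using less[of v u] that by auto
    then show "(u, v) \<in> r \<and> u \<noteq> v" using total that by (auto simp: total_on_def)
  qed (use less that in blast)
  moreover have "inj_on p V"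
  proof (rule inj_onI, rule ccontr)
    fix u v assume uv: "u \<in> V" "v \<in> V" "p u = p v" "u \<noteq> v"
    then have "(u, v) \<in> r \<or> (v, u) \<in> r" using total by (auto simp: total_on_def)
    then show False using less[of u v] less[of v u] uv by auto
  qed
  ultimately show ?thesis by blast
qed

lemma ex_arranged_arrangeability:
  assumes G: "pair_graph G"
  shows "\<exists>p. arranged G (arrangeability G) p"
proof -
  let ?V = "pverts G"
  have fin: "finite ?V" using pair_graph_finite[OF G] .
  let ?P = "\<lambda>k. \<exists>r. linear_order_on ?V r \<and> (\<forall>v\<in>?V. card {u \<in> ?V. (u, v) \<in> r \<and> u \<noteq> v \<and>
       (\<exists>w \<in> neighbors G u \<inter> neighbors G v. (v, w) \<in> r \<and> v \<noteq> w)} \<le> k)"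
  \<comment> \<open>The minimum is attained because any well-order satisfies the bound
    \<open>card ?V\<close>.\<close>
  obtain r0 where "well_order_on ?V r0" using well_order_on by blast
  then have "linear_order_on ?V r0" by (simp add: well_order_on_def)
  then have "?P (card ?V)" using fin by (intro exI[of _ r0] conjI ballI card_mono) auto
  then have "?P (LEAST k. ?P k)" by (rule LeastI)
  then obtain r where r: "linear_order_on ?V r"
    and k: "\<forall>v\<in>?V. card {u \<in> ?V. (u, v) \<in> r \<and> u \<noteq> v \<and>
       (\<exists>w \<in> neighbors G u \<inter> neighbors G v. (v, w) \<in> r \<and> v \<noteq> w)} \<le> arrangeability G"
    unfolding arrangeability_def by blast
  obtain p :: "'a \<Rightarrow> nat" where p: "inj_on p ?V" "\<forall>u\<in>?V. \<forall>v\<in>?V. p u < p v \<longleftrightarrow> (u, v) \<in> r \<and> u \<noteq> v"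
    using linear_order_on_position[OF fin r] by blast
  have "card {u \<in> ?V. p u < p v \<and> (\<exists>w \<in> neighbors G u \<inter> neighbors G v. p v < p w)} \<le> arrangeability G"
    if v: "v \<in> ?V" for v
  proof -
    have "{u \<in> ?V. p u < p v \<and> (\<exists>w \<in> neighbors G u \<inter> neighbors G v. p v < p w)}
        = {u \<in> ?V. (u, v) \<in> r \<and> u \<noteq> v \<and>
            (\<exists>w \<in> neighbors G u \<inter> neighbors G v. (v, w) \<in> r \<and> v \<noteq> w)}"
      using p(2) v neighbors_subset[OF G, of v] by blast
    then show ?thesis using k v by simp
  qed
  then show ?thesis using p(1) by (auto simp: arranged_def)
qed

lemma arranged_mono: "arranged G k p \<Longrightarrow> k \<le> k' \<Longrightarrow> arranged G k' p"
  by (auto simp: arranged_def intro: order_trans)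

section \<open>Greedy colourings\<close>

text \<open>Colour by increasing position: at \<open>v\<close> the set \<open>C v\<close> lies
  strictly earlier, hence is already coloured, and blocks at most \<open>card (C v)\<close>
  colours.\<close>

lemma ex_greedy_coloring:
  fixes p :: "'a \<Rightarrow> nat" and L :: "'a \<Rightarrow> nat set"
  assumes before: "\<And>v. v \<in> V \<Longrightarrow> finite (C v) \<and> (\<forall>u\<in>C v. p u < p v) \<and> card (C v) < card (L v)"
    and fin: "\<And>v. v \<in> V \<Longrightarrow> finite (L v)" and V: "finite V"
  shows "\<exists>c. \<forall>v\<in>V. c v \<in> L v \<and> c v \<notin> c ` C v"
proof -
  have "\<exists>c. \<forall>v\<in>V. p v < n \<longrightarrow> c v \<in> L v \<and> c v \<notin> c ` C v" for n
  proof (induction n)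
    case 0
    then show ?case by simp
  next
    case (Suc n)
    then obtain c where c: "\<And>v. v \<in> V \<Longrightarrow> p v < n \<Longrightarrow> c v \<in> L v \<and> c v \<notin> c ` C v" by blast
    have "\<exists>x. x \<in> L v - c ` C v" if v: "v \<in> V" for v
    proof -
      have "card (c ` C v) < card (L v)" using before[OF v] card_image_le[of "C v" c] by linarith
      then have "\<not> L v \<subseteq> c ` C v" using before[OF v] card_mono[of "c ` C v" "L v"] by auto
      then show ?thesis by blast
    qed
    then obtain x where x: "\<And>v. v \<in> V \<Longrightarrow> x v \<in> L v - c ` C v" by metis
    define c' where "c' v = (if p v = n then x v else c v)" for v
    have "c' v \<in> L v \<and> c' v \<notin> c' ` C v" if v: "v \<in> V" "p v < Suc n" for v
    proof -
      have "c' u = c u" if "u \<in> C v" for u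
        using before[OF v(1)] that v(2) by (auto simp: c'_def)
      then have "c' ` C v = c ` C v" by (rule image_cong[OF refl])
      then show ?thesis using c[OF v(1)] x[OF v(1)] v(2) by (auto simp: c'_def less_Suc_eq)
    qed
    then show ?case by blast
  qed
  from this[of "Suc (Max (p ` V))"] show ?thesis using V by (auto simp: less_Suc_eq_le)
qed

abbreviation earlier_neighbors :: "'a pair_pre_digraph \<Rightarrow> ('a \<Rightarrow> nat) \<Rightarrow> 'a \<Rightarrow> 'a set" where
  "earlier_neighbors G p v \<equiv> {w \<in> neighbors G v. p w < p v}"

abbreviation linked_later :: "'a pair_pre_digraph \<Rightarrow> ('a \<Rightarrow> nat) \<Rightarrow> 'a \<Rightarrow> 'a set" where
  "linked_later G p v \<equiv> {u \<in> pverts G. p u < p v \<and> (\<exists>w \<in> neighbors G u \<inter> neighbors G v. p v < p w)}"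

text \<open>The latest earlier neighbour of \<open>v\<close> is linked through \<open>v\<close> to all the other ones.\<close>

lemma arranged_card_earlier_neighbors:
  assumes G: "pair_graph G" and p: "arranged G k p" and v: "v \<in> pverts G"
  shows "card (earlier_neighbors G p v) \<le> k + 1"
proof (cases "earlier_neighbors G p v = {}")
  case False
  let ?Z = "earlier_neighbors G p v"
  have fin: "finite ?Z" using finite_neighbors[OF G] by simp
  have "Max (p ` ?Z) \<in> p ` ?Z" using False fin by (intro Max_in) auto
  then obtain x where x1: "x \<in> ?Z" "Max (p ` ?Z) = p x" by (rule imageE)
  have "p y \<le> p x" if "y \<in> ?Z" for y
    using Max_ge[of "p ` ?Z" "p y"] fin that unfolding x1(2) by blast
  then have x: "x \<in> ?Z" "\<forall>y\<in>?Z. p y \<le> p x" using x1(1) by blast+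
  have xV: "x \<in> pverts G" using x neighbors_subset[OF G] by blast
  have "?Z - {x} \<subseteq> linked_later G p x"
  proof
    fix y assume y: "y \<in> ?Z - {x}"
    then have yV: "y \<in> pverts G" using neighbors_subset[OF G] by blast
    have "p y \<noteq> p x" using p y yV xV by (auto simp: arranged_def inj_on_def)
    then have "p y < p x" using x y by (simp add: le_neq_implies_less)
    moreover have "v \<in> neighbors G y \<inter> neighbors G x" using x y neighbors_sym[OF G] by blast
    ultimately show "y \<in> linked_later G p x" using x yV by blast
  qed
  then have "card (?Z - {x}) \<le> card (linked_later G p x)"
    using pair_graph_finite[OF G] by (intro card_mono) auto
  also have "\<dots> \<le> k" using p xV by (simp add: arranged_def)
  finally show ?thesis using card.remove[OF fin x(1)] by simp
next
  case True
  show ?thesis unfolding True by simp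
qed

text \<open>An earlier \<open>u\<close> conflicts with \<open>v\<close> through a centre
  \<open>w\<close>. If \<open>w\<close> is later than \<open>v\<close>, arrangeability counts
  \<open>u\<close>; if earlier, \<open>w\<close> is one of at most \<open>k + 1\<close> earlier
  neighbours of \<open>v\<close>, each contributing at most \<open>r - 1\<close> conflicts.\<close>

lemma arranged_imp_system_coloring:
  assumes G: "pair_graph G" and p: "arranged G k p" and S: "neighborhood_system G \<Sigma>"
    and r: "\<And>w. w \<in> pverts G \<Longrightarrow> card (\<Sigma> w) \<le> r" "r \<ge> 1"
    and L: "lists_of_size_at_least G ((k + 1) * r) L"
  shows "\<exists>c. system_list_coloring G \<Sigma> L c"
proof -
  let ?V = "pverts G"
  have finV: "finite ?V" using pair_graph_finite[OF G] .
  have sub: "\<Sigma> w \<subseteq> neighbors G w" if "w \<in> ?V" for w using S that by (simp add: neighborhood_system_def)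
  define C where "C v = {u \<in> ?V. p u < p v \<and> (\<exists>w\<in>?V. u \<in> \<Sigma> w \<and> v \<in> \<Sigma> w)}" for v
  have card: "card (C v) < (k + 1) * r" if v: "v \<in> ?V" for v
  proof -
    let ?Z = "{w \<in> earlier_neighbors G p v. v \<in> \<Sigma> w}"
    have finZ: "finite ?Z" using finite_neighbors[OF G] by simp
    have finS: "finite (\<Sigma> w)" if "w \<in> ?Z" for w
      using that sub[of w] neighbors_subset[OF G] finite_neighbors[OF G] finite_subset by blast
    have "C v \<subseteq> linked_later G p v \<union> (\<Union>w\<in>?Z. \<Sigma> w - {v})"
    proof
      fix u assume "u \<in> C v"
      then obtain w where u: "u \<in> ?V" "p u < p v" and w: "w \<in> ?V" "u \<in> \<Sigma> w" "v \<in> \<Sigma> w"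
        by (auto simp: C_def)
      have nb: "w \<in> neighbors G u" "w \<in> neighbors G v" using sub w neighbors_sym[OF G] by blast+
      have "w \<noteq> v" using nb neighbors_irrefl[OF G] by blast
      then have "p w \<noteq> p v" using p w v by (auto simp: arranged_def inj_on_def)
      then have "p w < p v \<or> p v < p w" by linarith
      moreover have "u \<noteq> v" using u by blast
      ultimately show "u \<in> linked_later G p v \<union> (\<Union>w\<in>?Z. \<Sigma> w - {v})" using u w nb by blast
    qed
    then have "card (C v) \<le> card (linked_later G p v \<union> (\<Union>w\<in>?Z. \<Sigma> w - {v}))"
      using finV finZ finS by (intro card_mono) auto
    also have "\<dots> \<le> card (linked_later G p v) + card (\<Union>w\<in>?Z. \<Sigma> w - {v})" by (rule card_Un_le)
    also have "card (\<Union>w\<in>?Z. \<Sigma> w - {v}) \<le> (\<Sum>w\<in>?Z. card (\<Sigma> w - {v}))" using finZ by (rule card_UN_le)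
    also have "\<dots> \<le> (\<Sum>w\<in>?Z. r - 1)"
    proof (rule sum_mono)
      fix w assume w: "w \<in> ?Z"
      then have "card (\<Sigma> w) \<le> r" using neighbors_subset[OF G] r(1) by blast
      then show "card (\<Sigma> w - {v}) \<le> r - 1" using w finS[OF w] by simp
    qed
    also have "\<dots> = card ?Z * (r - 1)" by simp
    also have "\<dots> \<le> card (earlier_neighbors G p v) * (r - 1)"
      using finite_neighbors[OF G] by (intro mult_right_mono card_mono) auto
    also have "\<dots> \<le> (k + 1) * (r - 1)"
      using arranged_card_earlier_neighbors[OF G p v] by (rule mult_right_mono) simp
    also have "card (linked_later G p v) \<le> k" using p v by (simp add: arranged_def)
    finally have "card (C v) \<le> k + (k + 1) * (r - 1)" by simp
    \<comment> \<open>The left side is \<open>(k + 1) * r - 1\<close>, one below the list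
      size.\<close>
    also have "\<dots> < (k + 1) * r" using r(2) by (cases r) auto
    finally show ?thesis .
  qed
  have "\<exists>c. \<forall>v\<in>?V. c v \<in> L v \<and> c v \<notin> c ` C v"
  proof (rule ex_greedy_coloring[where p = p])
    fix v assume v: "v \<in> ?V"
    then have "finite (L v)" "(k + 1) * r \<le> card (L v)" using L by (auto simp: lists_of_size_at_least_def)
    then show "finite (C v) \<and> (\<forall>u\<in>C v. p u < p v) \<and> card (C v) < card (L v)" "finite (L v)"
      using card[OF v] finV by (auto simp: C_def)
  qed (rule finV)
  then obtain c where c: "\<And>v. v \<in> ?V \<Longrightarrow> c v \<in> L v" "\<And>u v. v \<in> ?V \<Longrightarrow> u \<in> C v \<Longrightarrow> c v \<noteq> c u"
    by (metis imageI)
  have "c u \<noteq> c v" if w: "w \<in> ?V" "u \<in> \<Sigma> w" "v \<in> \<Sigma> w" and "u \<noteq> v" for u v w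
  proof -
    have uv: "u \<in> ?V" "v \<in> ?V" using w sub neighbors_subset[OF G] by blast+
    then have "p u \<noteq> p v" using p \<open>u \<noteq> v\<close> by (auto simp: arranged_def inj_on_def)
    then have "u \<in> C v \<or> v \<in> C u" using w uv by (auto simp: C_def)
    then show ?thesis using c(2) uv by metis
  qed
  then have "system_list_coloring G \<Sigma> L c" using c(1) by (auto simp: system_list_coloring_def)
  then show ?thesis by blast
qed

section \<open>Star colourings and bicoloured paths\<close>

lemma arcs_ends_induce [simp]:
  "arcs_ends (with_proj G \<restriction> S) = {(x, y) \<in> parcs G. x \<in> S \<and> y \<in> S}"
  by (auto simp: arcs_ends_def arc_to_ends_def)

text \<open>All four vertices lie in the component of \<open>x\<close>, a star, so each of the three
  edges contains its centre; this forces a repetition.\<close>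

lemma star_forest_path:
  assumes G: "pair_graph G" and S: "S \<subseteq> pverts G" and star: "star_forest (with_proj G \<restriction> S)"
    and arcs: "(x, y) \<in> parcs G" "(y, z) \<in> parcs G" "(z, w) \<in> parcs G"
    and inS: "{x, y, z, w} \<subseteq> S"
  shows "x = z \<or> y = w \<or> x = w"
proof -
  interpret pair_graph G by (rule G)
  let ?H = "with_proj G \<restriction> S"
  have ind: "induced_subgraph ?H (with_proj G)" using S by (intro induced_induce) simp
  interpret H: sym_digraph ?H
    using induced_graph_imp_symmetric[OF pair_sym_arcs ind] wellformed_induce_subgraph
    by (simp add: sym_digraph_def sym_digraph_axioms_def)
  let ?C = "{v. x \<rightarrow>\<^sup>*\<^bsub>?H\<^esub> v}"
  have "?H \<restriction> ?C \<in> H.sccs" using inS by (intro H.induce_reachable_is_in_sccs) simp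
  then have "is_star (?H \<restriction> ?C)" using star by (simp add: star_forest_def)
  then obtain c where c: "arcs_ends (?H \<restriction> ?C) = {c} \<times> (?C - {c}) \<union> (?C - {c}) \<times> {c}"
    by (auto simp: is_star_def)
  have "x \<rightarrow>\<^sup>*\<^bsub>?H\<^esub> x" using inS by simp
  moreover from this have "x \<rightarrow>\<^sup>*\<^bsub>?H\<^esub> y" using arcs(1) inS by (auto intro: H.reachable_adj_trans)
  moreover from this have "x \<rightarrow>\<^sup>*\<^bsub>?H\<^esub> z" using arcs(2) inS by (auto intro: H.reachable_adj_trans)
  moreover from this have "x \<rightarrow>\<^sup>*\<^bsub>?H\<^esub> w" using arcs(3) inS by (auto intro: H.reachable_adj_trans)
  ultimately have "{(x, y), (y, z), (z, w)} \<subseteq> arcs_ends (?H \<restriction> ?C)"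
    using arcs inS by (auto simp: arcs_ends_conv)
  then have "{(x, y), (y, z), (z, w)} \<subseteq> {c} \<times> (?C - {c}) \<union> (?C - {c}) \<times> {c}" unfolding c .
  then show ?thesis by auto
qed

lemma star_coloring_bicolored_path:
  assumes G: "pair_graph G" and c: "star_coloring G c"
    and arcs: "(x, y) \<in> parcs G" "(y, z) \<in> parcs G" "(z, w) \<in> parcs G"
    and col: "c x = c z" "c y = c w"
  shows "x = z \<or> y = w"
proof -
  interpret pair_graph G by (rule G)
  have ne: "c x \<noteq> c y" using c arcs(1) by (auto simp: star_coloring_def proper_coloring_def)
  then have "star_forest (with_proj G \<restriction> {v \<in> pverts G. c v = c x \<or> c v = c y})"
    using c by (simp add: star_coloring_def)
  then have "x = z \<or> y = w \<or> x = w"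
    using arcs col by (intro star_forest_path[OF G]) (auto dest: in_arcsD1 in_arcsD2)
  then show ?thesis using ne col by auto
qed

text \<open>Properness and two colours make colours alternate along walks, so every path on four
  vertices in \<open>H\<close> would be bicoloured. A connected graph without such a path here has
  all vertices within distance one of a suitable centre.\<close>

lemma bicolored_path_free_is_star:
  assumes G: "pair_graph G" and proper: "proper_coloring G c"
    and free: "\<And>x y z w. (x, y) \<in> parcs G \<Longrightarrow> (y, z) \<in> parcs G \<Longrightarrow> (z, w) \<in> parcs G \<Longrightarrow>
      c x = c z \<Longrightarrow> c y = c w \<Longrightarrow> x = z \<or> y = w"
    and two: "\<And>v. v \<in> verts H \<Longrightarrow> c v = i \<or> c v = j"
    and ends: "arcs_ends H = {(x, y) \<in> parcs G. x \<in> verts H \<and> y \<in> verts H}"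
    and conn: "strongly_connected H"
  shows "is_star H"
proof -
  interpret pair_graph G by (rule G)
  have sym: "(y, x) \<in> parcs G" if "(x, y) \<in> parcs G" for x y
    using pair_sym_arcs that by (auto simp: symmetric_def dest: symD)
  have ne: "c x \<noteq> c y" if "(x, y) \<in> parcs G" for x y
    using proper that by (auto simp: proper_coloring_def)
  have same: "c x = c z" if "(x, y) \<in> parcs G" "(y, z) \<in> parcs G" "{x, y, z} \<subseteq> verts H" for x y z
    using ne[OF that(1)] ne[OF that(2)] two[of x] two[of y] two[of z] that(3) by auto
  let ?A = "arcs_ends H"
  have A: "(x, y) \<in> ?A \<longleftrightarrow> (x, y) \<in> parcs G \<and> x \<in> verts H \<and> y \<in> verts H" for x y
    using ends by auto
  \<comment> \<open>The centre is a vertex with two neighbours if one exists; otherwise it is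
    arbitrary and no vertex has two neighbours.\<close>
  obtain z where z: "z \<in> verts H"
    and branch: "(\<exists>x y. x \<noteq> y \<and> (z, x) \<in> ?A \<and> (z, y) \<in> ?A) \<or>
      (\<forall>v x y. (v, x) \<in> ?A \<and> (v, y) \<in> ?A \<longrightarrow> x = y)"
  proof (cases "\<exists>v x y. x \<noteq> y \<and> (v, x) \<in> ?A \<and> (v, y) \<in> ?A")
    case True
    then show ?thesis using that A by blast
  next
    case False
    moreover obtain v where "v \<in> verts H" using conn by (auto simp: strongly_connected_def)
    ultimately show ?thesis using that by blast
  qed
  \<comment> \<open>Otherwise \<open>y\<close> has the two neighbours \<open>x\<close> and
    \<open>z\<close>, so \<open>z\<close> has a second neighbour \<open>y'\<close> by its choice,
    and \<open>y', z, y, x\<close> is bicoloured.\<close>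
  have leaf: "x = z" if zyx: "(z, y) \<in> ?A" "(y, x) \<in> ?A" for x y
  proof (rule ccontr)
    assume xz: "x \<noteq> z"
    have "(y, z) \<in> ?A" using zyx(1) sym by (auto simp: A)
    then obtain a b where "a \<noteq> b" "(z, a) \<in> ?A" "(z, b) \<in> ?A" using branch zyx(2) xz by blast
    then obtain y' where y': "(z, y') \<in> ?A" "y' \<noteq> y" by blast
    have "c y' = c y" using same[of y' z y] y' zyx sym by (auto simp: A)
    moreover have "c z = c x" using same[of z y x] zyx by (auto simp: A)
    ultimately show False
      using free[of y' z y x] y' zyx sym xz by (auto simp: A)
  qed
  have reach: "v = z \<or> (z, v) \<in> ?A" if "v \<in> verts H" for v
  proof -
    have "(z, v) \<in> rtrancl_on (verts H) ?A"
      using conn z that by (auto simp: strongly_connected_def reachable_def)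
    then show ?thesis
    proof (induction rule: rtrancl_on_induct)
      case base
      then show ?case by simp
    next
      case (step x y)
      then show ?case using leaf by blast
    qed
  qed
  have "?A = {z} \<times> (verts H - {z}) \<union> (verts H - {z}) \<times> {z}"
  proof (intro equalityI subrelI)
    fix x y assume xy: "(x, y) \<in> ?A"
    then have "x \<noteq> y" using ne by (auto simp: A)
    moreover have "x = z \<or> y = z" using reach[of x] leaf xy by (auto simp: A)
    ultimately show "(x, y) \<in> {z} \<times> (verts H - {z}) \<union> (verts H - {z}) \<times> {z}" using xy by (auto simp: A)
  next
    fix x y assume "(x, y) \<in> {z} \<times> (verts H - {z}) \<union> (verts H - {z}) \<times> {z}"
    then show "(x, y) \<in> ?A" using reach sym by (auto simp: A)
  qed
  then show ?thesis using z by (auto simp: is_star_def)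
qed

lemma star_coloringI:
  assumes G: "pair_graph G" and proper: "proper_coloring G c"
    and free: "\<And>x y z w. (x, y) \<in> parcs G \<Longrightarrow> (y, z) \<in> parcs G \<Longrightarrow> (z, w) \<in> parcs G \<Longrightarrow>
      c x = c z \<Longrightarrow> c y = c w \<Longrightarrow> x = z \<or> y = w"
  shows "star_coloring G c"
  unfolding star_coloring_def star_forest_def
proof (intro conjI allI impI ballI)
  fix i j C
  let ?S = "{v \<in> pverts G. c v = i \<or> c v = j}"
  assume "C \<in> pre_digraph.sccs (with_proj G \<restriction> ?S)"
  then have C: "induced_subgraph C (with_proj G \<restriction> ?S)" "strongly_connected C"
    by (auto simp: pre_digraph.sccs_def)
  have sub: "verts C \<subseteq> ?S" using subgraph_imp_subverts[OF induced_imp_subgraph[OF C(1)]] by simp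
  have C': "tail C = fst" "head C = snd" "arcs C = {e \<in> parcs G. fst e \<in> verts C \<and> snd e \<in> verts C}"
    using C(1) sub by (auto simp: induced_subgraph_def subgraph_def compatible_def)
  have "arcs_ends C = {(x, y) \<in> parcs G. x \<in> verts C \<and> y \<in> verts C}"
    unfolding arcs_ends_conv C' by auto
  then show "is_star C" 
    using sub by (intro bicolored_path_free_is_star[OF G proper free _ _ C(2), of i j]) auto
qed (rule proper)

text \<open>
  The conflicts make the middle vertex of every bicoloured path on three vertices its first one,
  so the two middle vertices of a bicoloured path on four vertices would precede each other.
\<close>

lemma arranged_imp_star_coloring:
  assumes G: "pair_graph G" and p: "arranged G k p"
    and L: "lists_of_size_at_least G (k + (k + 1) + (k + 1) * (k + 1) + 1) L"
  shows "\<exists>c. star_coloring G c \<and> (\<forall>v\<in>pverts G. c v \<in> L v)"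
proof -
  let ?V = "pverts G" and ?B = "earlier_neighbors G p"
  have finV: "finite ?V" using pair_graph_finite[OF G] .
  have finB: "finite (?B v)" for v using finite_neighbors[OF G] by simp
  have cardB: "card (?B v) \<le> k + 1" if "v \<in> ?V" for v
    using arranged_card_earlier_neighbors[OF G p that] .
  have less: "p u < p v \<or> p v < p u" if "u \<in> ?V" "v \<in> ?V" "u \<noteq> v" for u v
  proof -
    have "p u \<noteq> p v" using p that by (auto simp: arranged_def inj_on_def)
    then show ?thesis by linarith
  qed
  \<comment> \<open>Conflicts of three kinds, at most \<open>k\<close>, \<open>k + 1\<close> and
    \<open>(k + 1) * (k + 1)\<close> in number: links through a later vertex, earlier neighbours,
    and earlier neighbours of these.\<close>
  define C where "C v = linked_later G p v \<union> ?B v \<union> (\<Union>w\<in>?B v. ?B w)" for v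
  have "\<exists>c. \<forall>v\<in>?V. c v \<in> L v \<and> c v \<notin> c ` C v"
  proof (rule ex_greedy_coloring[where p = p])
    fix v assume v: "v \<in> ?V"
    then have L': "finite (L v)" "k + (k + 1) + (k + 1) * (k + 1) + 1 \<le> card (L v)"
      using L by (auto simp: lists_of_size_at_least_def)
    have "card (C v) \<le> card (linked_later G p v \<union> ?B v) + card (\<Union>w\<in>?B v. ?B w)"
      unfolding C_def by (rule card_Un_le)
    also have "card (linked_later G p v \<union> ?B v) \<le> card (linked_later G p v) + card (?B v)"
      by (rule card_Un_le)
    also have "card (linked_later G p v) \<le> k" using p v by (simp add: arranged_def)
    also have "card (?B v) \<le> k + 1" using cardB[OF v] .
    also have "card (\<Union>w\<in>?B v. ?B w) \<le> (\<Sum>w\<in>?B v. card (?B w))" using finB by (rule card_UN_le)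
    also have "\<dots> \<le> (\<Sum>w\<in>?B v. k + 1)"
      using cardB neighbors_subset[OF G] by (intro sum_mono) blast
    also have "\<dots> = card (?B v) * (k + 1)" by simp
    also have "\<dots> \<le> (k + 1) * (k + 1)" using cardB[OF v] by (rule mult_right_mono) simp
    finally have "card (C v) < card (L v)" using L'(2) by simp
    moreover have "finite (C v)" using finV finB by (simp add: C_def)
    moreover have "\<forall>u\<in>C v. p u < p v" by (auto simp: C_def)
    ultimately show "finite (C v) \<and> (\<forall>u\<in>C v. p u < p v) \<and> card (C v) < card (L v)" "finite (L v)"
      using L'(1) by blast+
  qed (rule finV)
  then obtain c where c: "\<And>v. v \<in> ?V \<Longrightarrow> c v \<in> L v" "\<And>u v. v \<in> ?V \<Longrightarrow> u \<in> C v \<Longrightarrow> c v \<noteq> c u"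
    by (metis imageI)
  have nb: "(x, y) \<in> parcs G \<Longrightarrow> y \<in> neighbors G x \<and> x \<in> neighbors G y \<and> x \<in> ?V \<and> y \<in> ?V \<and> x \<noteq> y" for x y
    using neighbors_subset[OF G] neighbors_sym[OF G] neighbors_irrefl[OF G]
    unfolding neighbors_def by blast
  have "proper_coloring G c"
    unfolding proper_coloring_def
  proof clarify
    fix x y assume xy: "(x, y) \<in> parcs G" "c x = c y"
    then have "x \<in> C y \<or> y \<in> C x" using less nb[OF xy(1)] by (auto simp: C_def)
    then show False using c(2) nb[OF xy(1)] xy(2) by metis
  qed
  moreover have min: "p y < p x \<and> p y < p z"
    if "(x, y) \<in> parcs G" "(y, z) \<in> parcs G" "c x = c z" "x \<noteq> z" for x y z
  proof -
    \<comment> \<open>Here \<open>x\<close> is the later end. A middle \<open>y\<close> after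
      \<open>x\<close> would link \<open>z\<close> to \<open>x\<close> through a later
      vertex.\<close>
    have *: "p y < p x" if "p z < p x" "(x, y) \<in> parcs G" "(y, z) \<in> parcs G" "c x = c z" for x z
    proof (rule ccontr)
      assume "\<not> p y < p x"
      then have "p x < p y" using less nb[OF that(2)] by blast
      then have "z \<in> C x" using nb[OF that(2)] nb[OF that(3)] that(1) by (auto simp: C_def)
      then show False using c(2) nb[OF that(2)] that(4) by metis
    qed
    \<comment> \<open>With \<open>y\<close> before \<open>x\<close> known, a middle \<open>y\<close>
      after \<open>z\<close> would make \<open>z\<close> an earlier neighbour of an earlier
      neighbour of \<open>x\<close>.\<close>
    have **: "p y < p z" if "p z < p x" "(x, y) \<in> parcs G" "(y, z) \<in> parcs G" "c x = c z" for x z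
    proof (rule ccontr)
      assume "\<not> p y < p z"
      then have "p z < p y" using less nb[OF that(3)] by blast
      then have "z \<in> C x" using nb[OF that(2)] nb[OF that(3)] *[OF that] by (auto simp: C_def)
      then show False using c(2) nb[OF that(2)] that(4) by metis
    qed
    have rev: "(z, y) \<in> parcs G" "(y, x) \<in> parcs G"
      using nb[OF that(1)] nb[OF that(2)] by (auto simp: neighbors_def)
    show ?thesis
      using less[of x z] nb[OF that(1)] nb[OF that(2)] that(4)
        *[OF _ that(1,2,3)] **[OF _ that(1,2,3)] *[OF _ rev that(3)[symmetric]] **[OF _ rev that(3)[symmetric]]
      by blast
  qed
  have "star_coloring G c"
  proof (rule star_coloringI[OF G \<open>proper_coloring G c\<close>], rule ccontr)
    fix x y z w
    assume "(x, y) \<in> parcs G" "(y, z) \<in> parcs G" "(z, w) \<in> parcs G" "c x = c z" "c y = c w"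
      "\<not> (x = z \<or> y = w)"
    then have "p y < p z" "p z < p y" using min[of x y z] min[of y z w] by blast+
    then show False by simp
  qed
  then show ?thesis using c(1) by blast
qed

section \<open>The equivalences\<close>

lemma not_pair_degenerate_ex:
  assumes G: "pair_graph G" and d: "\<not> pair_degenerate G d"
  shows "\<exists>U W g. U \<subseteq> pverts G \<and> U \<noteq> {} \<and> W \<subseteq> pverts G - U \<and>
    (\<forall>w\<in>W. g w \<subseteq> neighbors G w \<inter> U \<and> card (g w) = 2) \<and>
    (\<forall>u\<in>U. d \<le> card {x \<in> U. x \<noteq> u \<and> {u, x} \<in> g ` W})"
proof -
  obtain U W g where U: "U \<subseteq> pverts G" "U \<noteq> {}" "W \<subseteq> pverts G - U" "inj_on g W"
    and g: "\<And>w. w \<in> W \<Longrightarrow> g w \<subseteq> neighbors G w \<inter> U \<and> card (g w) = 2"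
    and large: "\<And>u. u \<in> U \<Longrightarrow> d \<le> card {w \<in> W. u \<in> g w}"
    using d unfolding pair_degenerate_def by (meson not_less)
  have "d \<le> card {x \<in> U. x \<noteq> u \<and> {u, x} \<in> g ` W}" if u: "u \<in> U" for u
  proof -
    have fin: "finite U" using U(1) pair_graph_finite[OF G] finite_subset by blast
    have "g ` {w \<in> W. u \<in> g w} \<subseteq> (\<lambda>x. {u, x}) ` {x \<in> U. x \<noteq> u \<and> {u, x} \<in> g ` W}"
    proof
      fix e assume "e \<in> g ` {w \<in> W. u \<in> g w}"
      then obtain w where w: "w \<in> W" "e = g w" "u \<in> e" by blast
      then have "card e = 2" using g by blast
      then obtain a b where "e = {a, b}" "a \<noteq> b" by (auto simp: card_2_iff)
      then obtain x where "e = {u, x}" "x \<noteq> u" using w(3) by (metis insertE insert_commute singletonD)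
      then show "e \<in> (\<lambda>x. {u, x}) ` {x \<in> U. x \<noteq> u \<and> {u, x} \<in> g ` W}" using w g[OF w(1)] by blast
    qed
    then have "card (g ` {w \<in> W. u \<in> g w}) \<le> card {x \<in> U. x \<noteq> u \<and> {u, x} \<in> g ` W}"
      using fin by (intro surj_card_le) auto
    moreover have "card (g ` {w \<in> W. u \<in> g w}) = card {w \<in> W. u \<in> g w}"
      using U(4) by (intro card_image) (auto intro: inj_on_subset)
    ultimately show ?thesis using large[OF u] by simp
  qed
  then have "\<forall>u\<in>U. d \<le> card {x \<in> U. x \<noteq> u \<and> {u, x} \<in> g ` W}" by (rule ballI)
  moreover have "\<forall>w\<in>W. g w \<subseteq> neighbors G w \<inter> U \<and> card (g w) = 2" using g by (rule ballI)
  ultimately show ?thesis using U(1-3) by (intro exI[of _ U] exI[of _ W] exI[of _ g] conjI)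
qed

lemma star_choosable_imp_pair_degenerate:
  assumes s: "s \<ge> 2"
  shows "\<exists>d. \<forall>G :: 'a pair_pre_digraph. pair_graph G \<and>
    (\<forall>L. lists_of_size_at_least G s L \<longrightarrow> (\<exists>c. star_coloring G c \<and> (\<forall>v\<in>pverts G. c v \<in> L v))) \<longrightarrow>
    pair_degenerate G d"
proof -
  obtain d where d: "\<forall>(U :: 'a set) S. finite U \<and> U \<noteq> {} \<and> (\<forall>v\<in>U. S v \<subseteq> U \<and> d \<le> card (S v)) \<longrightarrow>
    (\<exists>L :: 'a \<Rightarrow> nat set. (\<forall>v. finite (L v) \<and> card (L v) = s) \<and>
       (\<forall>c. (\<forall>v\<in>U. c v \<in> L v) \<longrightarrow> (\<exists>v\<in>U. s < card {u \<in> S v. c u = c v})))"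
    using ex_lists_forcing_defect[OF s] by (rule exE)
  show ?thesis
  proof (intro exI[of _ d] allI impI, elim conjE, rule ccontr)
    fix G :: "'a pair_pre_digraph"
    assume G: "pair_graph G" and nd: "\<not> pair_degenerate G d"
      and choosable: "\<forall>L. lists_of_size_at_least G s L \<longrightarrow>
        (\<exists>c. star_coloring G c \<and> (\<forall>v\<in>pverts G. c v \<in> L v))"
    obtain U W g where U: "U \<subseteq> pverts G" "U \<noteq> {}" and W: "W \<subseteq> pverts G - U"
      and g: "\<forall>w\<in>W. g w \<subseteq> neighbors G w \<inter> U \<and> card (g w) = 2"
      and deg: "\<forall>u\<in>U. d \<le> card {x \<in> U. x \<noteq> u \<and> {u, x} \<in> g ` W}"
      using not_pair_degenerate_ex[OF G nd] by (elim exE conjE) (rule that; assumption)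
    have finU: "finite U" using U pair_graph_finite[OF G] finite_subset by blast
    define S where "S u = {x \<in> U. x \<noteq> u \<and> {u, x} \<in> g ` W}" for u
    have "finite U \<and> U \<noteq> {} \<and> (\<forall>v\<in>U. S v \<subseteq> U \<and> d \<le> card (S v))"
      using finU U deg by (auto simp: S_def)
    from d[THEN spec[of _ U], THEN spec[of _ S], THEN mp, OF this]
    obtain L :: "'a \<Rightarrow> nat set" where L: "\<forall>v. finite (L v) \<and> card (L v) = s"
      and defect: "\<forall>c. (\<forall>v\<in>U. c v \<in> L v) \<longrightarrow> (\<exists>v\<in>U. s < card {u \<in> S v. c u = c v})"
      by (elim exE conjE) (rule that; assumption)
    \<comment> \<open>All subdivision vertices share the palette \<open>{..<s}\<close>, so more than
      \<open>s\<close> of them around \<open>v\<close> must repeat a colour.\<close>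
    have "lists_of_size_at_least G s (\<lambda>v. if v \<in> U then L v else {..<s})"
      using L by (simp add: lists_of_size_at_least_def)
    then obtain c where c: "star_coloring G c"
      and cL: "\<And>v. v \<in> pverts G \<Longrightarrow> c v \<in> (if v \<in> U then L v else {..<s})"
      using choosable by blast
    have "\<forall>v\<in>U. c v \<in> L v"
    proof
      fix v assume "v \<in> U"
      then show "c v \<in> L v" using cL[of v] U by auto
    qed
    then obtain v where v: "v \<in> U" "s < card {u \<in> S v. c u = c v}" using spec[OF defect, of c] by blast
    let ?X = "{u \<in> S v. c u = c v}"
    have "\<forall>x\<in>?X. \<exists>w. w \<in> W \<and> g w = {v, x}" by (auto simp: S_def)
    then obtain m where m: "\<And>x. x \<in> ?X \<Longrightarrow> m x \<in> W \<and> g (m x) = {v, x}" by metis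
    have "(c \<circ> m) ` ?X \<subseteq> {..<s}"
    proof
      fix i assume "i \<in> (c \<circ> m) ` ?X"
      then obtain x where "x \<in> ?X" "i = c (m x)" by auto
      then show "i \<in> {..<s}" using m[of x] W cL[of "m x"] by auto
    qed
    then have "card ((c \<circ> m) ` ?X) \<le> card {..<s}" by (rule card_mono[rotated]) simp
    then have "\<not> inj_on (c \<circ> m) ?X" using v(2) by (intro pigeonhole) simp
    then obtain x y where xy: "x \<in> ?X" "y \<in> ?X" "x \<noteq> y" "c (m x) = c (m y)" by (auto simp: inj_on_def)
    have "x \<in> neighbors G (m x)" "v \<in> neighbors G (m x)" "v \<in> neighbors G (m y)"
      using m[OF xy(1)] m[OF xy(2)] bspec[OF g, of "m x"] bspec[OF g, of "m y"] by auto
    \<comment> \<open>The walk \<open>x, m x, v, m y\<close> is bicoloured, since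
      \<open>c x = c v\<close> and \<open>c (m x) = c (m y)\<close>.\<close>
    then have arcs: "(x, m x) \<in> parcs G" "(m x, v) \<in> parcs G" "(v, m y) \<in> parcs G"
      using neighbors_sym[OF G] by (auto simp: neighbors_def)
    have "g (m x) = {v, x}" "g (m y) = {v, y}" using m xy(1,2) by blast+
    then have "m x \<noteq> m y" using xy(3) by (metis doubleton_eq_iff)
    moreover have "x = v \<or> m x = m y"
      using xy(1,4) by (intro star_coloring_bicolored_path[OF G c arcs]) (auto simp: S_def)
    ultimately show False using xy(1) by (auto simp: S_def)
  qed
qed

lemma system_choosable_imp_pair_degenerate:
  assumes s: "s \<ge> 2"
  shows "\<exists>d. \<forall>G :: 'a pair_pre_digraph. pair_graph G \<and>
    (\<forall>\<Sigma> L. neighborhood_system G \<Sigma> \<and> rho G \<Sigma> = 2 \<and> lists_of_size_at_least G s L \<longrightarrow>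
       (\<exists>c. system_list_coloring G \<Sigma> L c)) \<longrightarrow>
    pair_degenerate G d"
proof -
  obtain d where d: "\<forall>(U :: 'a set) S. finite U \<and> U \<noteq> {} \<and> (\<forall>v\<in>U. S v \<subseteq> U \<and> d \<le> card (S v)) \<longrightarrow>
    (\<exists>L :: 'a \<Rightarrow> nat set. (\<forall>v. finite (L v) \<and> card (L v) = s) \<and>
       (\<forall>c. (\<forall>v\<in>U. c v \<in> L v) \<longrightarrow> (\<exists>v\<in>U. 0 < card {u \<in> S v. c u = c v})))"
    using ex_lists_forcing_defect[OF s] by (rule exE)
  show ?thesis
  proof (intro exI[of _ d] allI impI, elim conjE, rule ccontr)
    fix G :: "'a pair_pre_digraph"
    assume G: "pair_graph G" and nd: "\<not> pair_degenerate G d"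
      and choosable: "\<forall>\<Sigma> L. neighborhood_system G \<Sigma> \<and> rho G \<Sigma> = 2 \<and> lists_of_size_at_least G s L \<longrightarrow>
       (\<exists>c. system_list_coloring G \<Sigma> L c)"
    obtain U W g where U: "U \<subseteq> pverts G" "U \<noteq> {}" and W: "W \<subseteq> pverts G - U"
      and g: "\<forall>w\<in>W. g w \<subseteq> neighbors G w \<inter> U \<and> card (g w) = 2"
      and deg: "\<forall>u\<in>U. d \<le> card {x \<in> U. x \<noteq> u \<and> {u, x} \<in> g ` W}"
      using not_pair_degenerate_ex[OF G nd] by (elim exE conjE) (rule that; assumption)
    have finV: "finite (pverts G)" using pair_graph_finite[OF G] .
    have finU: "finite U" using U finV finite_subset by blast
    define S where "S u = {x \<in> U. x \<noteq> u \<and> {u, x} \<in> g ` W}" for u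
    have "finite U \<and> U \<noteq> {} \<and> (\<forall>v\<in>U. S v \<subseteq> U \<and> d \<le> card (S v))"
      using finU U deg by (auto simp: S_def)
    from d[THEN spec[of _ U], THEN spec[of _ S], THEN mp, OF this]
    obtain L :: "'a \<Rightarrow> nat set" where L: "\<forall>v. finite (L v) \<and> card (L v) = s"
      and defect: "\<forall>c. (\<forall>v\<in>U. c v \<in> L v) \<longrightarrow> (\<exists>v\<in>U. 0 < card {u \<in> S v. c u = c v})"
      by (elim exE conjE) (rule that; assumption)
    have edge: "\<exists>w\<in>W. \<exists>v u. g w = {v, u} \<and> v \<noteq> u \<and> c v = c u" if cL: "\<forall>v\<in>U. c v \<in> L v" for c
    proof -
      obtain v where "0 < card {u \<in> S v. c u = c v}" using spec[OF defect, of c] cL by blast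
      then have "{u \<in> S v. c u = c v} \<noteq> {}" by (metis card.empty less_irrefl)
      then obtain u where "u \<in> S v" "c v = c u" by force
      moreover from this obtain w where "w \<in> W" "g w = {v, u}" by (auto simp: S_def)
      ultimately show ?thesis by (intro bexI[of _ w] exI[of _ v] exI[of _ u]) (auto simp: S_def)
    qed
    \<comment> \<open>Only subdivision vertices act as centres, each with the two ends of its edge,
      so a system colouring properly colours the subdivided graph.\<close>
    define \<Sigma> where "\<Sigma> w = (if w \<in> W then g w else {})" for w
    have "neighborhood_system G \<Sigma>" using g by (auto simp: neighborhood_system_def \<Sigma>_def)
    moreover have "rho G \<Sigma> = 2"
    proof -
      \<comment> \<open>For the value 2 to be attained \<open>W\<close> must be nonempty; applying
        \<open>edge\<close> to an arbitrary choice from the lists yields an element.\<close>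
      have "L v \<noteq> {}" for v using L s by (metis card.empty not_numeral_le_zero)
      then have "\<forall>v\<in>U. (SOME i. i \<in> L v) \<in> L v" by (simp add: some_in_eq)
      then obtain w where w: "w \<in> W" using edge[of "\<lambda>v. SOME i. i \<in> L v"] by blast
      have "Max (insert 0 ((\<lambda>v. card (\<Sigma> v)) ` pverts G)) = 2"
      proof (rule Max_eqI)
        show "2 \<in> insert 0 ((\<lambda>v. card (\<Sigma> v)) ` pverts G)"
          using w bspec[OF g w] W by (auto simp: \<Sigma>_def intro!: image_eqI[of _ _ w])
      qed (use finV g in \<open>auto simp: \<Sigma>_def\<close>)
      then show ?thesis by (simp add: rho_def)
    qed
    moreover have "lists_of_size_at_least G s L" using L by (simp add: lists_of_size_at_least_def)
    ultimately obtain c where c: "system_list_coloring G \<Sigma> L c" using choosable by blast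
    then have "\<forall>v\<in>U. c v \<in> L v" using U by (auto simp: system_list_coloring_def)
    then obtain w v u where "w \<in> W" "g w = {v, u}" "v \<noteq> u" "c v = c u" using edge by blast
    moreover from this have "w \<in> pverts G" "v \<in> \<Sigma> w" "u \<in> \<Sigma> w" using W by (auto simp: \<Sigma>_def)
    ultimately show False using c unfolding system_list_coloring_def by blast
  qed
qed

lemma pair_degenerate_imp_arrangeability_bounded:
  "\<exists>k. \<forall>G :: 'a pair_pre_digraph. pair_graph G \<and> pair_degenerate G d \<longrightarrow> arrangeability G \<le> k"
  using ex_arranged_bound[of d] arranged_imp_arrangeability_le by blast

section \<open>Choice numbers as thresholds for list sizes\<close>

lemma lists_of_size_at_least_antimono:
  "lists_of_size_at_least G k L \<Longrightarrow> k' \<le> k \<Longrightarrow> lists_of_size_at_least G k' L"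
  by (auto simp: lists_of_size_at_least_def)

text \<open>The greedy colouring shows that some list size suffices, so the minimum is attained;
  larger lists inherit the property.\<close>

lemma star_choice_number_le_iff:
  assumes "pair_graph G"
  shows "star_choice_number G \<le> k \<longleftrightarrow> (\<forall>L. lists_of_size_at_least G k L \<longrightarrow>
    (\<exists>c. star_coloring G c \<and> (\<forall>v\<in>pverts G. c v \<in> L v)))" (is "_ \<longleftrightarrow> ?P k")
proof
  obtain p where p: "arranged G (arrangeability G) p" using ex_arranged_arrangeability[OF assms] ..
  have "\<exists>k. ?P k" using arranged_imp_star_coloring[OF assms p] by blast
  then have "?P (star_choice_number G)" unfolding star_choice_number_def by (rule LeastI_ex)
  then show "star_choice_number G \<le> k \<Longrightarrow> ?P k" using lists_of_size_at_least_antimono by blast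
  show "?P k \<Longrightarrow> star_choice_number G \<le> k" unfolding star_choice_number_def by (rule Least_le)
qed

lemma card_le_rho: "pair_graph G \<Longrightarrow> v \<in> pverts G \<Longrightarrow> card (\<Sigma> v) \<le> rho G \<Sigma>"
  unfolding rho_def using pair_graph_finite by (intro Max_ge) auto

text \<open>\<open>max 1\<close> covers systems with \<open>rho G \<Sigma> = 0\<close>, as the
  greedy bound asks for a positive \<open>r\<close>.\<close>

lemma arranged_imp_system_choosable:
  assumes "pair_graph G" "arranged G k p" "neighborhood_system G \<Sigma>"
    and "lists_of_size_at_least G ((k + 1) * max 1 (rho G \<Sigma>)) L"
  shows "\<exists>c. system_list_coloring G \<Sigma> L c"
  using assms card_le_rho[OF assms(1), of _ \<Sigma>]
  by (intro arranged_imp_system_coloring[of G k p \<Sigma> "max 1 (rho G \<Sigma>)"]) (auto simp: le_max_iff_disj)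

lemma system_choice_number_le_iff:
  assumes "pair_graph G" "neighborhood_system G \<Sigma>"
  shows "system_choice_number G \<Sigma> \<le> k \<longleftrightarrow>
    (\<forall>L. lists_of_size_at_least G k L \<longrightarrow> (\<exists>c. system_list_coloring G \<Sigma> L c))" (is "_ \<longleftrightarrow> ?P k")
proof
  obtain p where p: "arranged G (arrangeability G) p" using ex_arranged_arrangeability[OF assms(1)] ..
  have "\<exists>k. ?P k" using arranged_imp_system_choosable[OF assms(1) p assms(2)] by blast
  then have "?P (system_choice_number G \<Sigma>)" unfolding system_choice_number_def by (rule LeastI_ex)
  then show "system_choice_number G \<Sigma> \<le> k \<Longrightarrow> ?P k" using lists_of_size_at_least_antimono by blast
  show "?P k \<Longrightarrow> system_choice_number G \<Sigma> \<le> k" unfolding system_choice_number_def by (rule Least_le)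
qed

text \<open>Every set of the system is empty, so any choice from nonempty lists works. This treats
  the value 0, left out of the linear bound.\<close>

lemma system_choice_number_rho_0:
  assumes G: "pair_graph G" and S: "neighborhood_system G \<Sigma>" and rho: "rho G \<Sigma> = 0"
  shows "system_choice_number G \<Sigma> \<le> 1"
  unfolding system_choice_number_le_iff[OF G S]
proof (intro allI impI)
  fix L assume L: "lists_of_size_at_least G 1 L"
  have "\<Sigma> w = {}" if "w \<in> pverts G" for w
  proof -
    have "finite (\<Sigma> w)"
      using S that finite_neighbors[OF G] finite_subset unfolding neighborhood_system_def by blast
    then show ?thesis using card_le_rho[OF G that, of \<Sigma>] rho by simp
  qed
  moreover have "(SOME i. i \<in> L v) \<in> L v" if "v \<in> pverts G" for v
  proof -
    have "L v \<noteq> {}" using L that by (auto simp: lists_of_size_at_least_def)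
    then show ?thesis by (simp add: some_in_eq)
  qed
  ultimately have "system_list_coloring G \<Sigma> L (\<lambda>v. SOME i. i \<in> L v)"
    by (simp add: system_list_coloring_def)
  then show "\<exists>c. system_list_coloring G \<Sigma> L c" by blast
qed

lemma star_choice_number_bounded_imp_arrangeability_bounded:
  fixes \<F> :: "'a pair_pre_digraph set"
  assumes \<F>: "\<forall>G\<in>\<F>. pair_graph G" and k: "\<forall>G\<in>\<F>. star_choice_number G \<le> k"
  shows "\<exists>k. \<forall>G\<in>\<F>. arrangeability G \<le> k"
proof -
  \<comment> \<open>The lemma on forcing lists asks for size at least 2, hence
    \<open>max 2 k\<close>.\<close>
  have "2 \<le> max 2 k" by simp
  from star_choosable_imp_pair_degenerate[OF this, where ?'a='a]
  obtain d where d: "\<forall>G :: 'a pair_pre_digraph. pair_graph G \<and>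
    (\<forall>L. lists_of_size_at_least G (max 2 k) L \<longrightarrow>
      (\<exists>c. star_coloring G c \<and> (\<forall>v\<in>pverts G. c v \<in> L v))) \<longrightarrow> pair_degenerate G d" by (rule exE)
  have "pair_degenerate G d" if "G \<in> \<F>" for G
  proof -
    have G: "pair_graph G" using \<F> that by blast
    moreover have "star_choice_number G \<le> max 2 k" using k that by fastforce
    ultimately show ?thesis using d star_choice_number_le_iff[OF G] by blast
  qed
  then show ?thesis using pair_degenerate_imp_arrangeability_bounded[where d = d] \<F> by blast
qed

lemma system_choice_number_bounded_imp_arrangeability_bounded:
  fixes \<F> :: "'a pair_pre_digraph set"
  assumes \<F>: "\<forall>G\<in>\<F>. pair_graph G"
    and k: "\<And>G \<Sigma>. G \<in> \<F> \<Longrightarrow> neighborhood_system G \<Sigma> \<Longrightarrow> rho G \<Sigma> = 2 \<Longrightarrow> system_choice_number G \<Sigma> \<le> k"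
  shows "\<exists>k. \<forall>G\<in>\<F>. arrangeability G \<le> k"
proof -
  have "2 \<le> max 2 k" by simp
  from system_choosable_imp_pair_degenerate[OF this, where ?'a='a]
  obtain d where d: "\<forall>G :: 'a pair_pre_digraph. pair_graph G \<and>
    (\<forall>\<Sigma> L. neighborhood_system G \<Sigma> \<and> rho G \<Sigma> = 2 \<and> lists_of_size_at_least G (max 2 k) L \<longrightarrow>
       (\<exists>c. system_list_coloring G \<Sigma> L c)) \<longrightarrow> pair_degenerate G d" by (rule exE)
  have "pair_degenerate G d" if "G \<in> \<F>" for G
  proof -
    have G: "pair_graph G" using \<F> that by blast
    have "\<exists>c. system_list_coloring G \<Sigma> L c"
      if "neighborhood_system G \<Sigma>" "rho G \<Sigma> = 2" "lists_of_size_at_least G (max 2 k) L" for \<Sigma> L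
    proof -
      have "system_choice_number G \<Sigma> \<le> max 2 k" using k[OF \<open>G \<in> \<F>\<close> that(1,2)] by simp
      then show ?thesis using system_choice_number_le_iff[OF G that(1)] that(3) by blast
    qed
    then show ?thesis using d G by blast
  qed
  then show ?thesis using pair_degenerate_imp_arrangeability_bounded[where d = d] \<F> by blast
qed

theorem theorem8:
  fixes \<F> :: "'a pair_pre_digraph set"
  assumes "\<forall>G\<in>\<F>. pair_graph G"
  shows
    "((\<exists>k. \<forall>G\<in>\<F>. star_choice_number G \<le> k)
      \<longleftrightarrow> (\<exists>k. \<forall>G\<in>\<F>. arrangeability G \<le> k)) \<and>
     ((\<exists>k. \<forall>G\<in>\<F>. arrangeability G \<le> k)
      \<longleftrightarrow> (\<exists>C::real. \<forall>G\<in>\<F>. \<forall>\<Sigma>. neighborhood_system G \<Sigma> \<and> rho G \<Sigma> \<ge> 1 \<longrightarrow>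
             real (system_choice_number G \<Sigma>) \<le> C * real (rho G \<Sigma>))) \<and>
     ((\<exists>C::real. \<forall>G\<in>\<F>. \<forall>\<Sigma>. neighborhood_system G \<Sigma> \<and> rho G \<Sigma> \<ge> 1 \<longrightarrow>
             real (system_choice_number G \<Sigma>) \<le> C * real (rho G \<Sigma>))
      \<longleftrightarrow> (\<exists>f::nat \<Rightarrow> real. \<forall>G\<in>\<F>. \<forall>\<Sigma>. neighborhood_system G \<Sigma> \<longrightarrow>
             real (system_choice_number G \<Sigma>) \<le> f (rho G \<Sigma>))) \<and>
     ((\<exists>f::nat \<Rightarrow> real. \<forall>G\<in>\<F>. \<forall>\<Sigma>. neighborhood_system G \<Sigma> \<longrightarrow>
             real (system_choice_number G \<Sigma>) \<le> f (rho G \<Sigma>))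
      \<longleftrightarrow> (SUP (G, \<Sigma>)\<in>{(G, \<Sigma>). G \<in> \<F> \<and> neighborhood_system G \<Sigma> \<and> rho G \<Sigma> = 2}.
             enat (system_choice_number G \<Sigma>)) < \<infinity>)"
  (is "(?I \<longleftrightarrow> ?II) \<and> (_ \<longleftrightarrow> ?III) \<and> (_ \<longleftrightarrow> ?IV) \<and> (_ \<longleftrightarrow> ?V)")
proof -
  let ?P = "{(G, \<Sigma>). G \<in> \<F> \<and> neighborhood_system G \<Sigma> \<and> rho G \<Sigma> = 2}"
  have I_II: ?II if bounded: ?I
    using bounded star_choice_number_bounded_imp_arrangeability_bounded[OF assms] by blast
  have II_I: ?I if bounded: ?II
  proof -
    obtain k where k: "\<forall>G\<in>\<F>. arrangeability G \<le> k" using bounded by blast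
    have "star_choice_number G \<le> k + (k + 1) + (k + 1) * (k + 1) + 1" if F: "G \<in> \<F>" for G
    proof -
      have G: "pair_graph G" using assms F by blast
      obtain p where "arranged G k p" using ex_arranged_arrangeability[OF G] k F arranged_mono by blast
      then show ?thesis
        using arranged_imp_star_coloring[OF G] unfolding star_choice_number_le_iff[OF G] by blast
    qed
    then show ?thesis by blast
  qed
  have II_III: ?III if bounded: ?II
  proof -
    obtain k where k: "\<forall>G\<in>\<F>. arrangeability G \<le> k" using bounded by blast
    have "real (system_choice_number G \<Sigma>) \<le> real (k + 1) * real (rho G \<Sigma>)"
      if "G \<in> \<F>" and S: "neighborhood_system G \<Sigma>" and rho: "rho G \<Sigma> \<ge> 1" for G \<Sigma>
    proof -
      have G: "pair_graph G" using assms \<open>G \<in> \<F>\<close> by blast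
      obtain p where p: "arranged G k p"
        using ex_arranged_arrangeability[OF G] k \<open>G \<in> \<F>\<close> arranged_mono by blast
      have "system_choice_number G \<Sigma> \<le> (k + 1) * max 1 (rho G \<Sigma>)"
        using arranged_imp_system_choosable[OF G p S] unfolding system_choice_number_le_iff[OF G S] by blast
      then have "system_choice_number G \<Sigma> \<le> (k + 1) * rho G \<Sigma>" using rho by (simp add: max_def)
      then show ?thesis unfolding of_nat_mult[symmetric] of_nat_le_iff .
    qed
    then show ?thesis by blast
  qed
  have III_IV: ?IV if bounded: ?III
  proof -
    obtain C :: real where C: "\<forall>G\<in>\<F>. \<forall>\<Sigma>. neighborhood_system G \<Sigma> \<and> rho G \<Sigma> \<ge> 1 \<longrightarrow>
             real (system_choice_number G \<Sigma>) \<le> C * real (rho G \<Sigma>)" using bounded by blast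
    have "real (system_choice_number G \<Sigma>) \<le> (if rho G \<Sigma> = 0 then 1 else C * real (rho G \<Sigma>))"
      if "G \<in> \<F>" "neighborhood_system G \<Sigma>" for G \<Sigma>
      using C that assms system_choice_number_rho_0[of G \<Sigma>] by (cases "rho G \<Sigma> = 0") auto
    then show ?thesis by (intro exI[of _ "\<lambda>r. if r = 0 then 1 else C * real r"]) blast
  qed
  have IV_V: ?V if bounded: ?IV
  proof -
    obtain f :: "nat \<Rightarrow> real" where f: "\<forall>G\<in>\<F>. \<forall>\<Sigma>. neighborhood_system G \<Sigma> \<longrightarrow>
             real (system_choice_number G \<Sigma>) \<le> f (rho G \<Sigma>)" using bounded by blast
    \<comment> \<open>Rounding down gives a natural bound, which then bounds the supremum in
      \<open>enat\<close>.\<close>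
    have "system_choice_number G \<Sigma> \<le> nat \<lfloor>f 2\<rfloor>"
      if "G \<in> \<F>" "neighborhood_system G \<Sigma>" "rho G \<Sigma> = 2" for G \<Sigma>
      using f that by (metis le_nat_floor)
    then have "(SUP (G, \<Sigma>)\<in>?P. enat (system_choice_number G \<Sigma>)) \<le> enat (nat \<lfloor>f 2\<rfloor>)"
      by (intro SUP_least) auto
    then show ?thesis using enat_ord_simps(4) le_less_trans by blast
  qed
  have V_II: ?II if bounded: ?V
  proof -
    \<comment> \<open>A supremum below infinity is a natural number; for an empty family it is 0 and
      the bound on its members is vacuous.\<close>
    obtain k where k: "(SUP (G, \<Sigma>)\<in>?P. enat (system_choice_number G \<Sigma>)) = enat k"
      using bounded by (rule less_infinityE)
    have "system_choice_number G \<Sigma> \<le> k"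
      if "G \<in> \<F>" "neighborhood_system G \<Sigma>" "rho G \<Sigma> = 2" for G \<Sigma>
    proof -
      have "(case (G, \<Sigma>) of (G, \<Sigma>) \<Rightarrow> enat (system_choice_number G \<Sigma>)) \<le> enat k"
        unfolding k[symmetric] using that by (intro SUP_upper) auto
      then show ?thesis by simp
    qed
    then show ?thesis using system_choice_number_bounded_imp_arrangeability_bounded[OF assms] by blast
  qed
  show ?thesis
  \<comment> \<open>I and II imply each other, and the cycle II, III, IV, V, II yields the remaining
    implications by composition.\<close>
  proof (intro conjI)
    show "?I \<longleftrightarrow> ?II" using I_II II_I by (rule iffI)
    show "?II \<longleftrightarrow> ?III" using II_III V_II[OF IV_V[OF III_IV]] by (rule iffI)
    show "?III \<longleftrightarrow> ?IV" using III_IV II_III[OF V_II[OF IV_V]] by (rule iffI)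
    show "?IV \<longleftrightarrow> ?V" using IV_V III_IV[OF II_III[OF V_II]] by (rule iffI)
  qed
qed

end
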